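(* For every $\delta \in [0,1]$ there exist a metric measure space $(X,d,\mu)$ and a strongly local, regular Dirichlet form $(\mathcal{E},\mathcal{F})$ on $L^2(\mu)$ such that the critical Hölder exponent $\delta_*$ of $(X,d,\mu,\mathcal{E},\mathcal{F})$ is equal to $\delta$.
   Context: Here $(X,d,\mu)$ is a metric measure space: $(X,d)$ is a locally compact separable metric space and $\mu$ is a Radon measure on $X$ with full topological support (positive on non-empty open sets). $C_c(X)$ is the set of compactly supported continuous functions $X\to\mathbb{R}$, identified with a subset of $L^2(\mu)$. A Dirichlet form on $L^2(\mu)$ is a pair $(\mathcal{E},\mathcal{F})$ where $\mathcal{F}\subset L^2(\mu)$ is a dense linear subspace and $\mathcal{E}:\mathcal{F}\times\mathcal{F}\to\mathbb{R}$ is a non-negative definite (symmetric) bilinear form which is closed, i.e. $\mathcal{F}$ with the inner product $(f,g)\mapsto \int f g\,\mathrm{d}\mu+\mathcal{E}(f,g)$ is a Hilbert space, and Markovian, i.e. $f\in\mathcal{F}$ implies $\tilde f:=\min\{\max\{f,0\},1\}\in\mathcal{F}$ and $\mathcal{E}(\tilde f,\tilde f)\le\mathcal{E}(f,f)$. It is regular if $\mathcal{F}\cap C_c(X)$ is dense both in $(C_c(X),\|\cdot\|_\infty)$ and in $(\mathcal{F},\|\cdot\|_{\mathcal{F}})$, where $\|f\|_{\mathcal{F}}:=\|f\|_{L^2(\mu)}+\sqrt{\mathcal{E}(f,f)}$. It is strongly local if $\mathcal{E}(f,g)=0$ whenever $f,g\in\mathcal{F}$ have compact $\mathrm{supp}_\mu[f]$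 and $\mathrm{supp}_\mu[g]$ and $f$ is constant $\mu$-almost everywhere on an open neighborhood of $\mathrm{supp}_\mu[g]$; here $\mathrm{supp}_\mu[f]$ is the smallest closed set $F\subset X$ with $\int_{X\setminus F}|f|\,\mathrm{d}\mu=0$. For $\alpha\in(0,1]$, a function $f:X\to\mathbb{R}$ is $\alpha$-Hölder continuous if there is $K>0$ with $|f(x)-f(y)|\le K d(x,y)^\alpha$ for all $x,y\in X$. The critical Hölder exponent of $(X,d,\mu,\mathcal{E},\mathcal{F})$ is $$\delta_*:=\sup\{\alpha\in(0,1] : \text{there exists a non-constant } \alpha\text{-Hölder continuous } f\in\mathcal{F}\},$$ with $\delta_*=0$ if $\mathcal{F}$ contains no non-constant Hölder continuous function. *)

theory Defs
  imports "HOL-Analysis.Analysis"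
begin

text \<open>
  Regularity is required in the usual sense for Radon measures: outer regularity on Borel sets and
  inner regularity on open sets. The measure lives on the Borel sets of the metric
  topology; completing it would not change the associated \<open>L\<^sup>2\<close> space.
\<close>

definition radon_measure_on :: "'a topology \<Rightarrow> 'a measure \<Rightarrow> bool" where
  "radon_measure_on T \<mu> \<longleftrightarrow>
     space \<mu> = topspace T \<and>
     sets \<mu> = sigma_sets (topspace T) {U. openin T U} \<and>
     (\<forall>K. compactin T K \<longrightarrow> emeasure \<mu> K < \<infinity>) \<and>
     (\<forall>B \<in> sets \<mu>. emeasure \<mu> B = (INF U \<in> {U. openin T U \<and> B \<subseteq> U}. emeasure \<mu> U)) \<and>
     (\<forall>U. openin T U \<longrightarrow>
        emeasure \<mu> U = (SUP K \<in> {K. compactin T K \<and> K \<subseteq> U}. emeasure \<mu> K))"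

locale metric_measure_space = Metric_space X d
  for X :: "'a set" and d :: "'a \<Rightarrow> 'a \<Rightarrow> real" +
  fixes \<mu> :: "'a measure"
  assumes nonempty: "X \<noteq> {}"
    and locally_compact: "locally_compact_space mtopology"
    and separable: "separable_space mtopology"
    and radon: "radon_measure_on mtopology \<mu>"
    and full_support: "\<And>U. openin mtopology U \<Longrightarrow> U \<noteq> {} \<Longrightarrow> emeasure \<mu> U > 0"

text \<open>
  Elements of \<open>L\<^sup>2(\<mu>)\<close> are handled through representatives: a subset of \<open>L\<^sup>2(\<mu>)\<close> is a set of
  square-integrable functions saturated under equality almost everywhere. Values of
  functions outside \<open>space \<mu>\<close> are irrelevant throughout.
\<close>

definition L2 :: "'a measure \<Rightarrow> ('a \<Rightarrow> real) set" where
  "L2 \<mu> = {f \<in> borel_measurable \<mu>. integrable \<mu> (\<lambda>x. (f x)\<^sup>2)}"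

definition L2_norm :: "'a measure \<Rightarrow> ('a \<Rightarrow> real) \<Rightarrow> real" where
  "L2_norm \<mu> f = sqrt (\<integral>x. (f x)\<^sup>2 \<partial>\<mu>)"

text \<open>The inner product \<open>\<integral> f g d\<mu> + \<E>(f, g)\<close> on the domain of a form.\<close>

definition form_inner ::
    "'a measure \<Rightarrow> (('a \<Rightarrow> real) \<Rightarrow> ('a \<Rightarrow> real) \<Rightarrow> real) \<Rightarrow> ('a \<Rightarrow> real) \<Rightarrow> ('a \<Rightarrow> real) \<Rightarrow> real" where
  "form_inner \<mu> E f g = (\<integral>x. f x * g x \<partial>\<mu>) + E f g"

text \<open>
  \<open>F_AE\<close> and \<open>E_AE\<close> say that \<open>F\<close> and \<open>E\<close> descend to almost-everywhere classes. Given the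
  other axioms, \<open>form_inner\<close> is automatically a (definite) inner product on these classes, so
  \<open>closed_form\<close> is exactly the Hilbert space condition.
\<close>

locale dirichlet_form =
  fixes \<mu> :: "'a measure"
    and E :: "('a \<Rightarrow> real) \<Rightarrow> ('a \<Rightarrow> real) \<Rightarrow> real"
    and F :: "('a \<Rightarrow> real) set"
  assumes F_subset: "F \<subseteq> L2 \<mu>"
    and F_AE: "\<And>f g. f \<in> F \<Longrightarrow> g \<in> borel_measurable \<mu> \<Longrightarrow> AE x in \<mu>. f x = g x \<Longrightarrow> g \<in> F"
    and F_zero: "(\<lambda>x. 0) \<in> F"
    and F_add: "\<And>f g. f \<in> F \<Longrightarrow> g \<in> F \<Longrightarrow> (\<lambda>x. f x + g x) \<in> F"
    and F_scale: "\<And>c f. f \<in> F \<Longrightarrow> (\<lambda>x. c * f x) \<in> F"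
    and F_dense: "\<And>f \<epsilon>. f \<in> L2 \<mu> \<Longrightarrow> \<epsilon> > 0 \<Longrightarrow> \<exists>g\<in>F. L2_norm \<mu> (\<lambda>x. f x - g x) < \<epsilon>"
    and E_AE: "\<And>f f' g. f \<in> F \<Longrightarrow> f' \<in> F \<Longrightarrow> g \<in> F \<Longrightarrow> AE x in \<mu>. f x = f' x \<Longrightarrow> E f g = E f' g"
    and E_sym: "\<And>f g. f \<in> F \<Longrightarrow> g \<in> F \<Longrightarrow> E f g = E g f"
    and E_add: "\<And>f g h. f \<in> F \<Longrightarrow> g \<in> F \<Longrightarrow> h \<in> F \<Longrightarrow> E (\<lambda>x. f x + g x) h = E f h + E g h"
    and E_scale: "\<And>c f g. f \<in> F \<Longrightarrow> g \<in> F \<Longrightarrow> E (\<lambda>x. c * f x) g = c * E f g"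
    and E_nonneg: "\<And>f. f \<in> F \<Longrightarrow> E f f \<ge> 0"
    and closed_form: "\<And>s :: nat \<Rightarrow> 'a \<Rightarrow> real.
          (\<And>n. s n \<in> F) \<Longrightarrow>
          (\<And>\<epsilon>. \<epsilon> > 0 \<Longrightarrow> \<exists>N. \<forall>m\<ge>N. \<forall>n\<ge>N.
             sqrt (form_inner \<mu> E (\<lambda>x. s m x - s n x) (\<lambda>x. s m x - s n x)) < \<epsilon>) \<Longrightarrow>
          \<exists>f\<in>F. (\<lambda>n. sqrt (form_inner \<mu> E (\<lambda>x. s n x - f x) (\<lambda>x. s n x - f x))) \<longlonglongrightarrow> 0"
    and markov_dom: "\<And>f. f \<in> F \<Longrightarrow> (\<lambda>x. min (max (f x) 0) 1) \<in> F"
    and markov: "\<And>f. f \<in> F \<Longrightarrow> E (\<lambda>x. min (max (f x) 0) 1) (\<lambda>x. min (max (f x) 0) 1) \<le> E f f"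

definition form_norm ::
    "'a measure \<Rightarrow> (('a \<Rightarrow> real) \<Rightarrow> ('a \<Rightarrow> real) \<Rightarrow> real) \<Rightarrow> ('a \<Rightarrow> real) \<Rightarrow> real" where
  "form_norm \<mu> E f = L2_norm \<mu> f + sqrt (E f f)"

definition Cc :: "'a topology \<Rightarrow> ('a \<Rightarrow> real) set" where
  "Cc T = {f. continuous_map T euclideanreal f \<and>
              compactin T (T closure_of {x \<in> topspace T. f x \<noteq> 0})}"

text \<open>Sup-norm density is spelled out pointwise.\<close>

definition regular_form ::
    "'a topology \<Rightarrow> 'a measure \<Rightarrow> (('a \<Rightarrow> real) \<Rightarrow> ('a \<Rightarrow> real) \<Rightarrow> real) \<Rightarrow> ('a \<Rightarrow> real) set \<Rightarrow> bool" where
  "regular_form T \<mu> E F \<longleftrightarrow>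
     (\<forall>f \<in> Cc T. \<forall>\<epsilon>>0. \<exists>g \<in> F \<inter> Cc T. \<forall>x \<in> topspace T. \<bar>f x - g x\<bar> < \<epsilon>) \<and>
     (\<forall>f \<in> F. \<forall>\<epsilon>>0. \<exists>g \<in> F \<inter> Cc T. form_norm \<mu> E (\<lambda>x. f x - g x) < \<epsilon>)"

text \<open>
  The smallest closed set off which \<open>f\<close> has zero integral, as the intersection of all such sets
  (which is itself such a set when the topology is second countable).
\<close>

definition measure_support :: "'a topology \<Rightarrow> 'a measure \<Rightarrow> ('a \<Rightarrow> real) \<Rightarrow> 'a set" where
  "measure_support T \<mu> f =
     \<Inter> {C. closedin T C \<and> (\<integral>\<^sup>+x \<in> topspace T - C. ennreal \<bar>f x\<bar> \<partial>\<mu>) = 0}"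

definition strongly_local_form ::
    "'a topology \<Rightarrow> 'a measure \<Rightarrow> (('a \<Rightarrow> real) \<Rightarrow> ('a \<Rightarrow> real) \<Rightarrow> real) \<Rightarrow> ('a \<Rightarrow> real) set \<Rightarrow> bool" where
  "strongly_local_form T \<mu> E F \<longleftrightarrow>
     (\<forall>f \<in> F. \<forall>g \<in> F.
        compactin T (measure_support T \<mu> f) \<and> compactin T (measure_support T \<mu> g) \<and>
        (\<exists>U c. openin T U \<and> measure_support T \<mu> g \<subseteq> U \<and> (AE x in \<mu>. x \<in> U \<longrightarrow> f x = c))
        \<longrightarrow> E f g = 0)"

definition holder_continuous :: "'a set \<Rightarrow> ('a \<Rightarrow> 'a \<Rightarrow> real) \<Rightarrow> real \<Rightarrow> ('a \<Rightarrow> real) \<Rightarrow> bool" where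
  "holder_continuous X d \<alpha> f \<longleftrightarrow>
     (\<exists>K>0. \<forall>x\<in>X. \<forall>y\<in>X. \<bar>f x - f y\<bar> \<le> K * d x y powr \<alpha>)"

definition holder_exponents ::
    "'a set \<Rightarrow> ('a \<Rightarrow> 'a \<Rightarrow> real) \<Rightarrow> ('a \<Rightarrow> real) set \<Rightarrow> real set" where
  "holder_exponents X d F =
     {\<alpha>. 0 < \<alpha> \<and> \<alpha> \<le> 1 \<and> (\<exists>f\<in>F. holder_continuous X d \<alpha> f \<and> \<not> f constant_on X)}"

text \<open>\<open>\<mu>\<close> and \<open>\<E>\<close> enter only through the domain \<open>F\<close>.\<close>

definition critical_holder_exponent ::
    "'a set \<Rightarrow> ('a \<Rightarrow> 'a \<Rightarrow> real) \<Rightarrow> ('a \<Rightarrow> real) set \<Rightarrow> real" where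
  "critical_holder_exponent X d F =
     (if holder_exponents X d F = {} then 0 else Sup (holder_exponents X d F))"

end

theory Submission
  imports Defs
begin

text \<open>
  The space is always the unit interval with the Euclidean metric and Lebesgue measure; the exponent
  is encoded in the form alone. The form is the energy \<open>\<integral> (df/ds)\<^sup>2 ds\<close> of a one-dimensional diffusion
  with a continuous, strictly increasing, in general singular scale function \<open>s\<close>. A function of
  finite energy is absolutely continuous with respect to \<open>s\<close>, so its Hoelder regularity in the
  Euclidean metric is limited by that of \<open>s\<close>.

  No derivative is ever taken. The scale function is given by nested grids
  \<open>0 = G n 0 < \<dots> < G n (M n) = 1\<close> through \<open>s (G n i) = i / M n\<close>, and the energy is the limit of
  \<open>M n * (\<Sum>i < M n. (f (G n (i+1)) - f (G n i))\<^sup>2)\<close>, which increases with \<open>n\<close> by Cauchy-Schwarz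
  (\<open>energy_mono_Suc\<close>). The axioms can be read off from these finite sums: truncation contracts every
  increment, two functions with separated variation have no cell in common once the mesh is fine, and
  the sums are lower semicontinuous while the energy dominates the oscillation
  (\<open>oscillation_le_energy\<close>), which gives completeness. Regularity is the Stone-Weierstrass theorem for
  the algebra of functions that are Lipschitz in \<open>s\<close> (\<open>finite_energy_dense\<close>).

  The Euclidean lengths of the cells are what determines the exponent. A cell of level \<open>n\<close> is split
  into \<open>2 ^ (2n+1)\<close> children, so that there are \<open>M n = 2 ^ n\<^sup>2\<close> cells. Each of
  the light children gets the fraction \<open>(2 ^ (2n+1)) powr - p\<close> of its length, and two heavy ones share
  the rest. There are two opposite estimates.

  For constant \<open>p\<close> every cell of level \<open>n\<close> has length at least \<open>M n powr - p\<close>, and the quotient of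
  \<open>M (n+1)\<close> and \<open>M n\<close> grows more slowly than every power of \<open>M n\<close>. Hence \<open>s\<close> itself is \<open>\<alpha>\<close>-Hoelder whenever \<open>\<alpha> * p < 1\<close>
  (\<open>coordinate_Holder\<close>).

  Conversely, only a fraction \<open>4 powr - n\<close> of the children of the cells of level \<open>n\<close> is heavy, so all but a
  fraction of order \<open>4 powr - k\<close> of the cells has been light since level \<open>k\<close> and has length at most
  \<open>(M n / M k) powr - p\<close> (\<open>few_heavy_cells\<close>). If \<open>f\<close> is \<open>\<alpha>\<close>-Hoelder with \<open>\<alpha> * p > 1\<close>, then its variation
  over these cells is at most a constant times \<open>M n * M n powr - (\<alpha> * p)\<close> and tends to \<open>0\<close>. By
  Cauchy-Schwarz its variation over the remaining cells is at most the square root of the product of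
  their fraction and the energy of \<open>f\<close>, which is small for large \<open>k\<close>. So \<open>f\<close> is constant
  (\<open>Holder_variation_vanishes\<close>, \<open>Holder_finite_energy_constant\<close>).

  For \<open>\<delta> > 0\<close> the choice \<open>p = 1/\<delta>\<close> yields the exponent \<open>\<delta>\<close>. For \<open>\<delta> = 0\<close> the exponent \<open>p\<close> is made to grow
  with the level; the second estimate survives because a growing \<open>p\<close> makes light cells only shorter,
  and it excludes every \<open>\<alpha> > 0\<close>.
\<close>

section \<open>The unit interval with Lebesgue measure\<close>

definition unit_lebesgue :: "real measure" where
  "unit_lebesgue = restrict_space lborel {0..1}"

lemma space_unit_lebesgue [simp]: "space unit_lebesgue = {0..1}"
  by (simp add: unit_lebesgue_def space_restrict_space)

lemma sets_unit_lebesgue: "sets unit_lebesgue = {B \<in> sets borel. B \<subseteq> {0..1}}"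
  unfolding unit_lebesgue_def by (subst set_eq_iff) (simp add: sets_restrict_space_iff conj_commute)

lemma emeasure_unit_lebesgue: "B \<subseteq> {0..1} \<Longrightarrow> emeasure unit_lebesgue B = emeasure lborel B"
  by (simp add: unit_lebesgue_def emeasure_restrict_space)

lemma emeasure_unit_lebesgue_total: "emeasure unit_lebesgue {0..1} = 1"
  by (simp add: emeasure_unit_lebesgue)

lemma finite_measure_unit_lebesgue: "finite_measure unit_lebesgue"
  by (rule finite_measureI) (simp add: emeasure_unit_lebesgue_total)

lemma Metric_space_unit: "Metric_space {0..1::real} dist"
  by (rule Met_TC.subspace) auto

lemma mtopology_unit: "Metric_space.mtopology {0..1::real} dist = top_of_set {0..1}"
proof -
  interpret Submetric UNIV dist "{0..1::real}"
    by unfold_locales auto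
  show ?thesis using mtopology_submetric by simp
qed

lemma openin_unit_sets: "openin (top_of_set {0..1::real}) U \<Longrightarrow> U \<in> sets unit_lebesgue"
  by (auto simp: sets_unit_lebesgue openin_open)

lemma sets_unit_lebesgue_sigma:
  "sets unit_lebesgue = sigma_sets {0..1} {U. openin (top_of_set {0..1}) U}"
proof -
  have "sets unit_lebesgue = sets (restrict_space borel {0..1})"
    unfolding unit_lebesgue_def by (rule sets_restrict_space_cong) simp
  also have "\<dots> = sigma_sets {0..1} {{0..1} \<inter> S | S. open S}"
    using sigma_sets_Int[of "{0..1::real}" UNIV "{S. open S}"] borel_closed[of "{0..1::real}"]
    by (simp add: sets_restrict_space borel_def setcompr_eq_image)
  also have "{{0..1} \<inter> S | S. open S} = {U. openin (top_of_set {0..1::real}) U}"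
    by (auto simp: openin_open)
  finally show ?thesis .
qed

text \<open>
  The theorems on regularity of finite Borel measures on the line apply to the measure \<open>M\<close> with density
  the indicator of the interval. They transfer because relatively open sets are traces of open sets and
  compactness of a subset of the interval does not depend on the surrounding space.
\<close>

lemma radon_unit_lebesgue: "radon_measure_on (top_of_set {0..1}) unit_lebesgue"
proof -
  define M where "M = density lborel (indicator {0..1::real})"
  have sM: "sets M = sets borel" by (simp add: M_def)
  have eM: "emeasure M B = emeasure lborel ({0..1} \<inter> B)" if "B \<in> sets borel" for B
    using that by (simp add: M_def emeasure_density indicator_inter_arith[symmetric])
  have fM: "emeasure M (space M) \<noteq> \<infinity>"
    using eM[of UNIV] by (simp add: M_def)
  have eU: "emeasure unit_lebesgue B = emeasure M B" if "B \<in> sets unit_lebesgue" for B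
    using that by (auto simp: sets_unit_lebesgue emeasure_unit_lebesgue eM Int_absorb1)
  have eI: "emeasure unit_lebesgue ({0..1} \<inter> S) = emeasure M S" if "S \<in> sets borel" for S
    using that by (simp add: emeasure_unit_lebesgue eM)
  have outer: "emeasure unit_lebesgue B =
      (INF U \<in> {U. openin (top_of_set {0..1}) U \<and> B \<subseteq> U}. emeasure unit_lebesgue U)"
    if B: "B \<in> sets unit_lebesgue" for B
  proof (rule antisym)
    show "emeasure unit_lebesgue B \<le> (INF U \<in> {U. openin (top_of_set {0..1}) U \<and> B \<subseteq> U}. emeasure unit_lebesgue U)"
      by (auto intro!: INF_greatest emeasure_mono openin_unit_sets)
    have "(INF U \<in> {U. openin (top_of_set {0..1}) U \<and> B \<subseteq> U}. emeasure unit_lebesgue U)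
      \<le> (INF U \<in> {U. B \<subseteq> U \<and> open U}. emeasure M U)"
    proof (rule INF_mono)
      fix S assume "S \<in> {U. B \<subseteq> U \<and> open U}"
      then show "\<exists>U\<in>{U. openin (top_of_set {0..1}) U \<and> B \<subseteq> U}. emeasure unit_lebesgue U \<le> emeasure M S"
        using B by (intro bexI[of _ "{0..1} \<inter> S"]) (auto simp: eI sets_unit_lebesgue openin_open)
    qed
    also have "\<dots> = emeasure M B"
      using B by (intro outer_regular[symmetric] sM fM) (auto simp: sets_unit_lebesgue)
    finally show "(INF U \<in> {U. openin (top_of_set {0..1}) U \<and> B \<subseteq> U}. emeasure unit_lebesgue U)
      \<le> emeasure unit_lebesgue B"
      using B by (simp add: eU)
  qed
  have inner: "emeasure unit_lebesgue U =
      (SUP K \<in> {K. compactin (top_of_set {0..1}) K \<and> K \<subseteq> U}. emeasure unit_lebesgue K)"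
    if U: "openin (top_of_set {0..1}) U" for U
  proof -
    have "U \<in> sets unit_lebesgue" using U by (rule openin_unit_sets)
    then have "emeasure unit_lebesgue U = (SUP K \<in> {K. K \<subseteq> U \<and> compact K}. emeasure M K)"
      by (subst eU, simp, intro inner_regular sM fM) (auto simp: sets_unit_lebesgue)
    also have "\<dots> = (SUP K \<in> {K. compactin (top_of_set {0..1}) K \<and> K \<subseteq> U}. emeasure unit_lebesgue K)"
      using U openin_subset[OF U]
      by (intro SUP_cong) (auto simp: compactin_subtopology eU sets_unit_lebesgue borel_compact)
    finally show ?thesis .
  qed
  have "emeasure unit_lebesgue K < \<infinity>" for K
    using finite_measure.emeasure_finite[OF finite_measure_unit_lebesgue, of K]
    by (simp add: less_top)
  then show ?thesis
    unfolding radon_measure_on_def using outer inner by (auto simp: sets_unit_lebesgue_sigma)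
qed

lemma full_support_unit_lebesgue:
  assumes "openin (top_of_set {0..1::real}) U" "U \<noteq> {}"
  shows "emeasure unit_lebesgue U > 0"
proof -
  obtain x where x: "x \<in> U" using assms by auto
  obtain e where e: "e > 0" "ball x e \<inter> {0..1} \<subseteq> U"
    using assms(1) x unfolding openin_contains_ball by blast
  have x01: "0 \<le> x" "x \<le> 1" using openin_subset[OF assms(1)] x by auto
  define a b where "a = max 0 (x - e/2)" and "b = min 1 (x + e/2)"
  have ab: "a < b" "{a..b} \<subseteq> U"
    using e x01 by (auto simp: a_def b_def dist_real_def abs_if intro!: subsetD[OF e(2)])
  have "U \<subseteq> {0..1}" using openin_subset[OF assms(1)] by simp
  have "0 < emeasure lborel {a..b}" using ab by simp
  also have "\<dots> = emeasure unit_lebesgue {a..b}"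
    using subset_trans[OF ab(2) \<open>U \<subseteq> {0..1}\<close>] by (rule emeasure_unit_lebesgue[symmetric])
  also have "\<dots> \<le> emeasure unit_lebesgue U"
    using ab by (intro emeasure_mono openin_unit_sets assms) auto
  finally show ?thesis .
qed

lemma second_countable_euclidean:
  "second_countable (euclidean :: 'a::second_countable_topology topology)"
  unfolding second_countable_def using ex_countable_basis topological_basis_def
  by (metis open_openin topological_basisE)

lemma metric_measure_space_unit: "metric_measure_space {0..1} dist unit_lebesgue"
proof -
  interpret Metric_space "{0..1::real}" dist by (rule Metric_space_unit)
  show ?thesis
  proof
    show "{0..1::real} \<noteq> {}" by simp
    show "locally_compact_space mtopology"
      by (simp add: mtopology_unit compact_imp_locally_compact_space compact_space_subtopology)
    show "separable_space mtopology"
      unfolding mtopology_unit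
      by (intro second_countable_imp_separable_space second_countable_subtopology)
         (rule second_countable_euclidean)
    show "radon_measure_on mtopology unit_lebesgue"
      by (simp add: mtopology_unit radon_unit_lebesgue)
    show "emeasure unit_lebesgue U > 0" if "openin mtopology U" "U \<noteq> {}" for U
      using that by (simp add: mtopology_unit full_support_unit_lebesgue)
  qed
qed

lemma continuous_measurable_unit:
  assumes "continuous_on {0..1} (h :: real \<Rightarrow> real)"
  shows "h \<in> borel_measurable unit_lebesgue"
proof -
  have "sets unit_lebesgue = sets (restrict_space borel {0..1})"
    unfolding unit_lebesgue_def by (rule sets_restrict_space_cong) simp
  then show ?thesis
    using borel_measurable_continuous_on_restrict[OF assms] measurable_cong_sets by blast
qed

lemma continuous_integrable_unit:
  assumes "continuous_on {0..1} (h :: real \<Rightarrow> real)"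
  shows "integrable unit_lebesgue h"
proof -
  have "compact (h ` {0..1})" using assms by (rule compact_continuous_image) auto
  then have "bounded (h ` {0..1})" by (rule compact_imp_bounded)
  then obtain B where "\<And>x. x \<in> {0..1} \<Longrightarrow> norm (h x) \<le> B"
    unfolding bounded_iff by (metis imageI)
  then show ?thesis
    by (intro finite_measure.integrable_const_bound[OF finite_measure_unit_lebesgue, of _ B]
        AE_I2 continuous_measurable_unit assms) auto
qed

text \<open>
  If the equation failed at one point of \<open>V\<close>, then by continuity it would fail on a nonempty relatively
  open set, which has positive measure. This is how almost everywhere statements about elements of the
  domain become pointwise statements about their continuous versions.
\<close>

lemma continuous_AE_const_unit:
  assumes h: "continuous_on {0..1} (h :: real \<Rightarrow> real)"
    and V: "openin (top_of_set {0..1}) V"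
    and ae: "AE x in unit_lebesgue. x \<in> V \<longrightarrow> h x = c"
    and x: "x \<in> V"
  shows "h x = c"
proof (rule ccontr)
  assume ne: "h x \<noteq> c"
  have V01: "V \<subseteq> {0..1}" using openin_subset[OF V] by simp
  define W where "W = V \<inter> ({0..1} \<inter> h -` (- {c}))"
  have W: "openin (top_of_set {0..1}) W"
    unfolding W_def
    by (intro openin_Int V continuous_openin_preimage_gen[OF h]) auto
  have "x \<in> W" using ne x V01 by (auto simp: W_def)
  then have "emeasure unit_lebesgue W > 0" using W full_support_unit_lebesgue by blast
  moreover have "AE x in unit_lebesgue. x \<notin> W"
    using ae by eventually_elim (auto simp: W_def)
  then have "emeasure unit_lebesgue W = 0"
    using V01 by (subst (asm) AE_iff_measurable[OF openin_unit_sets[OF W]]) (auto simp: W_def)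
  ultimately show False by simp
qed

lemma continuous_AE_eq_unit:
  assumes "continuous_on {0..1} (h :: real \<Rightarrow> real)" "continuous_on {0..1} k"
    and ae: "AE x in unit_lebesgue. h x = k x"
    and x: "x \<in> {0..1}"
  shows "h x = k x"
proof -
  have "h x - k x = 0"
    by (rule continuous_AE_const_unit[where V="{0..1}" and h="\<lambda>x. h x - k x"])
      (use assms in \<open>auto intro!: continuous_intros simp: openin_open_eq\<close>)
  then show ?thesis by simp
qed

lemma Cc_unit: "Cc (top_of_set {0..1::real}) = {f. continuous_on {0..1} f}"
proof -
  have "compactin (top_of_set {0..1::real}) (top_of_set {0..1} closure_of S)" for S
    by (rule closedin_compact_space) (auto simp: compact_space_subtopology)
  moreover have "continuous_map (top_of_set {0..1}) euclideanreal f \<longleftrightarrow> continuous_on {0..1} f" for f :: "real \<Rightarrow> real"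
    by simp
  ultimately show ?thesis unfolding Cc_def by simp
qed

section \<open>Density of continuous functions in the square-integrable functions\<close>

lemma square_add_le: "(a + b)\<^sup>2 \<le> 2 * a\<^sup>2 + 2 * b\<^sup>2" for a b :: real
  using zero_le_power2[of "a - b"] by (simp add: power2_eq_square algebra_simps)

lemma L2_add:
  assumes "f \<in> L2 M" "g \<in> L2 M"
  shows "(\<lambda>x. f x + g x) \<in> L2 M"
proof -
  have [measurable]: "f \<in> borel_measurable M" "g \<in> borel_measurable M"
    and i: "integrable M (\<lambda>x. (f x)\<^sup>2)" "integrable M (\<lambda>x. (g x)\<^sup>2)"
    using assms by (auto simp: L2_def)
  have "integrable M (\<lambda>x. (f x + g x)\<^sup>2)"
  proof (rule Bochner_Integration.integrable_bound)
    show "integrable M (\<lambda>x. 2 * (f x)\<^sup>2 + 2 * (g x)\<^sup>2)" using i by simp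
    show "AE x in M. norm ((f x + g x)\<^sup>2) \<le> norm (2 * (f x)\<^sup>2 + 2 * (g x)\<^sup>2)"
      by (rule AE_I2) (simp add: square_add_le)
  qed simp
  then show ?thesis by (simp add: L2_def)
qed

lemma L2_scale: "f \<in> L2 M \<Longrightarrow> (\<lambda>x. c * f x) \<in> L2 M"
  unfolding L2_def by (simp add: power_mult_distrib borel_measurable_times)

lemma L2_diff:
  assumes "f \<in> L2 M" "g \<in> L2 M"
  shows "(\<lambda>x. f x - g x) \<in> L2 M"
  using L2_add[OF assms(1) L2_scale[OF assms(2), of "-1"]] by simp

lemma integral_square_add_le:
  assumes "f \<in> L2 M" "g \<in> L2 M"
  shows "(\<integral>x. (f x + g x)\<^sup>2 \<partial>M) \<le> 2 * (\<integral>x. (f x)\<^sup>2 \<partial>M) + 2 * (\<integral>x. (g x)\<^sup>2 \<partial>M)"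
proof -
  have i: "integrable M (\<lambda>x. (f x)\<^sup>2)" "integrable M (\<lambda>x. (g x)\<^sup>2)" "integrable M (\<lambda>x. (f x + g x)\<^sup>2)"
    using assms L2_add[OF assms] by (auto simp: L2_def)
  have "(\<integral>x. (f x + g x)\<^sup>2 \<partial>M) \<le> (\<integral>x. 2 * (f x)\<^sup>2 + 2 * (g x)\<^sup>2 \<partial>M)"
    using i by (intro integral_mono square_add_le) simp_all
  also have "\<dots> = 2 * (\<integral>x. (f x)\<^sup>2 \<partial>M) + 2 * (\<integral>x. (g x)\<^sup>2 \<partial>M)"
    using i by simp
  finally show ?thesis .
qed

lemma continuous_L2_unit:
  assumes "continuous_on {0..1} (h :: real \<Rightarrow> real)"
  shows "h \<in> L2 unit_lebesgue"
  unfolding L2_def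
  using continuous_measurable_unit[OF assms] continuous_integrable_unit[OF continuous_on_power[OF assms]]
  by simp

text \<open>
  Squared distances are used throughout, with \<open>integral_square_add_le\<close> as the substitute for the
  triangle inequality.
\<close>

definition L2_approximable :: "(real \<Rightarrow> real) \<Rightarrow> bool" where
  "L2_approximable f \<longleftrightarrow> f \<in> L2 unit_lebesgue \<and>
     (\<forall>e>0. \<exists>g. continuous_on {0..1} g \<and> (\<integral>x. (f x - g x)\<^sup>2 \<partial>unit_lebesgue) < e)"

lemma L2_approximable_limit:
  assumes f: "f \<in> L2 unit_lebesgue"
    and ex: "\<And>e. e > 0 \<Longrightarrow> \<exists>g. L2_approximable g \<and> (\<integral>x. (f x - g x)\<^sup>2 \<partial>unit_lebesgue) < e"
  shows "L2_approximable f"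
  unfolding L2_approximable_def
proof (intro conjI f allI impI)
  fix e :: real assume e: "e > 0"
  obtain g where g: "L2_approximable g" "(\<integral>x. (f x - g x)\<^sup>2 \<partial>unit_lebesgue) < e/4"
    using ex[of "e/4"] e by auto
  obtain h where h: "continuous_on {0..1} h" "(\<integral>x. (g x - h x)\<^sup>2 \<partial>unit_lebesgue) < e/4"
    using g(1) e unfolding L2_approximable_def by (meson divide_pos_pos zero_less_numeral)
  have gL: "g \<in> L2 unit_lebesgue" using g by (simp add: L2_approximable_def)
  have "(\<integral>x. ((f x - g x) + (g x - h x))\<^sup>2 \<partial>unit_lebesgue) < e"
    using integral_square_add_le[OF L2_diff[OF f gL] L2_diff[OF gL continuous_L2_unit[OF h(1)]]] g(2) h(2)
    by linarith
  then show "\<exists>g. continuous_on {0..1} g \<and> (\<integral>x. (f x - g x)\<^sup>2 \<partial>unit_lebesgue) < e"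
    using h(1) by (intro exI[of _ h]) simp
qed

lemma L2_approximable_add:
  assumes "L2_approximable f" "L2_approximable g"
  shows "L2_approximable (\<lambda>x. f x + g x)"
  unfolding L2_approximable_def
proof (intro conjI allI impI)
  have L: "f \<in> L2 unit_lebesgue" "g \<in> L2 unit_lebesgue"
    using assms by (auto simp: L2_approximable_def)
  then show "(\<lambda>x. f x + g x) \<in> L2 unit_lebesgue" by (rule L2_add)
  fix e :: real assume "e > 0"
  then have "e/4 > 0" by simp
  then obtain h k where h: "continuous_on {0..1} h" "(\<integral>x. (f x - h x)\<^sup>2 \<partial>unit_lebesgue) < e/4"
    and k: "continuous_on {0..1} k" "(\<integral>x. (g x - k x)\<^sup>2 \<partial>unit_lebesgue) < e/4"
    using assms unfolding L2_approximable_def by meson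
  have "(\<integral>x. ((f x - h x) + (g x - k x))\<^sup>2 \<partial>unit_lebesgue) < e"
    using integral_square_add_le[OF L2_diff[OF L(1) continuous_L2_unit[OF h(1)]]
        L2_diff[OF L(2) continuous_L2_unit[OF k(1)]]] h(2) k(2) by linarith
  then show "\<exists>h. continuous_on {0..1} h \<and> (\<integral>x. (f x + g x - h x)\<^sup>2 \<partial>unit_lebesgue) < e"
    using h(1) k(1) by (intro exI[of _ "\<lambda>x. h x + k x"]) (auto intro!: continuous_intros simp: algebra_simps)
qed

lemma L2_approximable_scale:
  assumes "L2_approximable f"
  shows "L2_approximable (\<lambda>x. c * f x)"
  unfolding L2_approximable_def
proof (intro conjI allI impI)
  show "(\<lambda>x. c * f x) \<in> L2 unit_lebesgue" using assms by (simp add: L2_approximable_def L2_scale)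
  fix e :: real assume e: "e > 0"
  have "e / (c\<^sup>2 + 1) > 0" using e by (simp add: add_nonneg_pos)
  then obtain h where h: "continuous_on {0..1} h"
    "(\<integral>x. (f x - h x)\<^sup>2 \<partial>unit_lebesgue) < e / (c\<^sup>2 + 1)"
    using assms unfolding L2_approximable_def by meson
  have "(\<integral>x. (c * f x - c * h x)\<^sup>2 \<partial>unit_lebesgue) = c\<^sup>2 * (\<integral>x. (f x - h x)\<^sup>2 \<partial>unit_lebesgue)"
    by (subst Bochner_Integration.integral_mult_right_zero[symmetric])
       (simp add: right_diff_distrib[symmetric] power_mult_distrib)
  also have "\<dots> \<le> (c\<^sup>2 + 1) * (\<integral>x. (f x - h x)\<^sup>2 \<partial>unit_lebesgue)"
    by (intro mult_right_mono) auto
  also have "\<dots> < e" using h(2) by (subst (asm) pos_less_divide_eq) (auto simp: mult.commute add_nonneg_pos)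
  finally show "\<exists>g. continuous_on {0..1} g \<and> (\<integral>x. (c * f x - g x)\<^sup>2 \<partial>unit_lebesgue) < e"
    using h(1) by (intro exI[of _ "\<lambda>x. c * h x"]) (auto intro!: continuous_intros)
qed

text \<open>
  Choose a closed set inside \<open>B\<close> and an open set around \<open>B\<close> with a gap of measure less than \<open>e\<close> between
  them. An Urysohn function for this pair differs from the indicator of \<open>B\<close> only on the gap, by at
  most \<open>1\<close>.
\<close>

lemma L2_approximable_indicator:
  assumes B: "B \<in> sets unit_lebesgue"
  shows "L2_approximable (indicator B)"
  unfolding L2_approximable_def
proof (intro conjI allI impI)
  interpret finite_measure unit_lebesgue by (rule finite_measure_unit_lebesgue)
  have Bm [measurable]: "B \<in> sets unit_lebesgue" by (rule B)
  show IB: "indicator B \<in> L2 unit_lebesgue"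
    unfolding L2_def by (auto intro!: integrable_const_bound[of _ 1] simp: indicator_def)
  fix e :: real assume e: "e > 0"
  have Bb: "B \<in> sets borel" "B \<subseteq> {0..1}" using B by (auto simp: sets_unit_lebesgue)
  have Bl: "B \<in> sets lebesgue" using Bb by simp
  obtain U where U: "open U" "B \<subseteq> U" "U - B \<in> lmeasurable" "emeasure lebesgue (U - B) < ennreal (e/2)"
    using sets_lebesgue_outer_open[OF Bl, of "e/2"] e by auto
  obtain T where T: "closed T" "T \<subseteq> B" "B - T \<in> lmeasurable" "emeasure lebesgue (B - T) < ennreal (e/2)"
    using sets_lebesgue_inner_closed[OF Bl, of "e/2"] e by auto
  have ce: "closed T" "closed (- U)" "T \<inter> (- U) = {}" using U T by auto
  obtain h :: "real \<Rightarrow> real" where h: "continuous_on UNIV h" "\<And>x. h x \<in> closed_segment 1 0"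
      "\<And>x. x \<in> T \<Longrightarrow> h x = 1" "\<And>x. x \<in> - U \<Longrightarrow> h x = 0"
    using Urysohn[OF ce, of "1::real" 0] by blast
  have h01: "0 \<le> h x" "h x \<le> 1" for x
    using h(2)[of x] by (auto simp: closed_segment_eq_real_ivl)
  define D where "D = (U - T) \<inter> {0..1}"
  have Dm [measurable]: "D \<in> sets unit_lebesgue"
    using U T by (auto simp: D_def sets_unit_lebesgue)
  have hc: "continuous_on {0..1} h" using h(1) continuous_on_subset by blast
  have le: "(indicator B x - h x)\<^sup>2 \<le> indicator D x" if "x \<in> {0..1}" for x
  proof (cases "x \<in> U - T")
    case True
    have "\<bar>indicator B x - h x\<bar> \<le> 1" using h01[of x] by (auto simp: indicator_def)
    then show ?thesis using True that by (simp add: D_def abs_square_le_1)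
  next
    case False
    then have "indicator B x = h x"
      using h(3)[of x] h(4)[of x] U(2) T(2) by (auto simp: indicator_def)
    then show ?thesis by simp
  qed
  have "D \<in> sets borel" using U T by (auto simp: D_def)
  then have "emeasure unit_lebesgue D = emeasure lebesgue D"
    by (simp add: emeasure_unit_lebesgue D_def)
  also have "\<dots> \<le> emeasure lebesgue ((U - B) \<union> (B - T))"
    using U T by (intro emeasure_mono) (auto simp: D_def)
  also have "\<dots> \<le> emeasure lebesgue (U - B) + emeasure lebesgue (B - T)"
    using U T by (intro emeasure_subadditive) auto
  also have "\<dots> < ennreal (e/2) + ennreal (e/2)"
    using U(4) T(4) by (intro add_strict_mono)
  also have "\<dots> = ennreal e" using e by (simp flip: ennreal_plus)
  finally have mD: "measure unit_lebesgue D < e"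
    using e by (simp add: emeasure_eq_measure ennreal_less_iff)
  have "(\<integral>x. (indicator B x - h x)\<^sup>2 \<partial>unit_lebesgue) \<le> (\<integral>x. indicator D x \<partial>unit_lebesgue)"
    using L2_diff[OF IB continuous_L2_unit[OF hc]] le
    by (intro integral_mono) (auto simp: L2_def emeasure_eq_measure)
  also have "\<dots> < e" using mD by (simp add: Int_absorb2 D_def)
  finally show "\<exists>g. continuous_on {0..1} g \<and> (\<integral>x. (indicator B x - g x)\<^sup>2 \<partial>unit_lebesgue) < e"
    using hc by blast
qed

lemma L2_approximable_sum:
  assumes "finite I" "\<And>i. i \<in> I \<Longrightarrow> L2_approximable (f i)"
  shows "L2_approximable (\<lambda>x. \<Sum>i\<in>I. f i x)"
  using assms
proof (induction I)
  case empty
  have "L2_approximable (\<lambda>x. 0 * indicator {} x)"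
    by (intro L2_approximable_scale L2_approximable_indicator) auto
  then show ?case by simp
next
  case (insert i I)
  then show ?case using L2_approximable_add[of "f i" "\<lambda>x. \<Sum>i\<in>I. f i x"] by simp
qed

lemma L2_approximable_simple:
  assumes s: "simple_function unit_lebesgue s"
  shows "L2_approximable (s :: real \<Rightarrow> real)"
proof (rule L2_approximable_limit)
  interpret finite_measure unit_lebesgue by (rule finite_measure_unit_lebesgue)
  have fin: "finite (s ` {0..1})" using simple_functionD(1)[OF s] by simp
  have [measurable]: "s \<in> borel_measurable unit_lebesgue"
    using s by (rule borel_measurable_simple_function)
  have "bounded (s ` {0..1})" using fin by (rule finite_imp_bounded)
  then obtain C where C: "\<And>x. x \<in> {0..1} \<Longrightarrow> \<bar>s x\<bar> \<le> C" 
    unfolding bounded_iff by (metis imageI real_norm_def)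
  then have "\<And>x. x \<in> {0..1} \<Longrightarrow> (s x)\<^sup>2 \<le> C\<^sup>2" by (meson abs_ge_zero abs_le_square_iff order_trans abs_ge_self)
  then show "s \<in> L2 unit_lebesgue"
    by (auto simp: L2_def intro!: integrable_const_bound[of _ "C\<^sup>2"] AE_I2)
  define t where "t x = (\<Sum>y\<in>s ` {0..1}. y * indicator (s -` {y} \<inter> {0..1}) x)" for x
  have "L2_approximable t"
    unfolding t_def using fin simple_functionD(2)[OF s]
    by (intro L2_approximable_sum L2_approximable_scale L2_approximable_indicator) auto
  moreover have "t x = s x" if "x \<in> {0..1}" for x
  proof -
    have "t x = (\<Sum>y\<in>s ` {0..1}. if y = s x then y else 0)"
      unfolding t_def using that by (intro sum.cong) (auto simp: indicator_def)
    also have "\<dots> = s x" using fin that by simp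
    finally show ?thesis .
  qed
  then have "(\<integral>x. (s x - t x)\<^sup>2 \<partial>unit_lebesgue) = (\<integral>x. 0 \<partial>unit_lebesgue)"
    by (intro Bochner_Integration.integral_cong) auto
  ultimately show "\<exists>g. L2_approximable g \<and> (\<integral>x. (s x - g x)\<^sup>2 \<partial>unit_lebesgue) < e" if "e > 0" for e
    using that by auto
qed

text \<open>
  Simple functions that converge pointwise and are dominated by \<open>2 * \<bar>f\<bar>\<close> also converge in the
  square mean, by dominated convergence with the majorant \<open>9 * f\<^sup>2\<close>.
\<close>

lemma L2_approximable_L2:
  assumes f: "f \<in> L2 unit_lebesgue"
  shows "L2_approximable f"
proof (rule L2_approximable_limit[OF f])
  fix e :: real assume e: "e > 0"
  have [measurable]: "f \<in> borel_measurable unit_lebesgue"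
    and fi: "integrable unit_lebesgue (\<lambda>x. (f x)\<^sup>2)" using f by (auto simp: L2_def)
  obtain s where s: "\<And>i. simple_function unit_lebesgue (s i)"
    "\<And>x. x \<in> {0..1} \<Longrightarrow> (\<lambda>i. s i x) \<longlonglongrightarrow> f x"
    "\<And>i x. x \<in> {0..1} \<Longrightarrow> \<bar>s i x\<bar> \<le> 2 * \<bar>f x\<bar>"
    using borel_measurable_implies_sequence_metric[of f unit_lebesgue 0]
    by (metis \<open>f \<in> borel_measurable unit_lebesgue\<close> dist_0_norm norm_conv_dist real_norm_def space_unit_lebesgue)
  have [measurable]: "s i \<in> borel_measurable unit_lebesgue" for i
    using s(1) by (rule borel_measurable_simple_function)
  have "(\<lambda>i. \<integral>x. (f x - s i x)\<^sup>2 \<partial>unit_lebesgue) \<longlonglongrightarrow> (\<integral>x. 0 \<partial>unit_lebesgue)"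
  proof (rule integral_dominated_convergence[where w="\<lambda>x. 9 * (f x)\<^sup>2"])
    show "integrable unit_lebesgue (\<lambda>x. 9 * (f x)\<^sup>2)" using fi by simp
    have "(\<lambda>i. (f x - s i x)\<^sup>2) \<longlonglongrightarrow> (f x - f x)\<^sup>2" if "x \<in> {0..1}" for x
      using s(2)[OF that] by (intro tendsto_intros)
    then show "AE x in unit_lebesgue. (\<lambda>i. (f x - s i x)\<^sup>2) \<longlonglongrightarrow> 0" by auto
    have "(f x - s i x)\<^sup>2 \<le> 9 * (f x)\<^sup>2" if "x \<in> {0..1}" for i x
    proof -
      have "\<bar>f x - s i x\<bar> \<le> \<bar>3 * f x\<bar>" using s(3)[OF that, of i] by linarith
      then show ?thesis unfolding abs_le_square_iff by (simp add: power_mult_distrib)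
    qed
    then show "AE x in unit_lebesgue. norm ((f x - s i x)\<^sup>2) \<le> 9 * (f x)\<^sup>2" for i by auto
  qed auto
  then have "\<forall>\<^sub>F i in sequentially. (\<integral>x. (f x - s i x)\<^sup>2 \<partial>unit_lebesgue) < e"
    using e by (intro order_tendstoD(2)) auto
  then obtain i where "(\<integral>x. (f x - s i x)\<^sup>2 \<partial>unit_lebesgue) < e"
    using eventually_happens sequentially_bot by blast
  then show "\<exists>g. L2_approximable g \<and> (\<integral>x. (f x - g x)\<^sup>2 \<partial>unit_lebesgue) < e"
    using L2_approximable_simple[OF s(1)] by blast
qed

section \<open>Discrete energies along a refining grid\<close>

text \<open>
  \<open>G n 0, \<dots>, G n (M n)\<close> are the points of level \<open>n\<close>, and each of the \<open>M n\<close> cells between consecutive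
  points is split into \<open>N n\<close> cells of the next level. The lengths of the cells are left open: every
  such grid gives a strongly local regular Dirichlet form, and the lengths matter only for the Hoelder
  exponent.
\<close>

locale refining_grid =
  fixes M N :: "nat \<Rightarrow> nat" and G :: "nat \<Rightarrow> nat \<Rightarrow> real"
  assumes M_0: "M 0 = 1"
    and M_Suc: "M (Suc n) = M n * N n"
    and N_ge: "2 \<le> N n"
    and G_first: "G n 0 = 0"
    and G_last: "G n (M n) = 1"
    and G_step: "i < M n \<Longrightarrow> G n i < G n (Suc i)"
    and G_refine: "i \<le> M n \<Longrightarrow> G (Suc n) (i * N n) = G n i"
    and mesh: "\<epsilon> > 0 \<Longrightarrow> \<exists>n0. \<forall>n\<ge>n0. \<forall>i<M n. G n (Suc i) - G n i < \<epsilon>"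
begin

lemma M_ge: "2 ^ n \<le> M n"
proof (induction n)
  case (Suc n)
  then show ?case using mult_le_mono[OF Suc N_ge[of n]] by (simp add: M_Suc mult.commute)
qed (simp add: M_0)

lemma M_pos: "0 < M n"
  using M_ge[of n] by (meson less_le_trans zero_less_numeral zero_less_power)

lemma M_eventually_large: "\<exists>n. c / real (M n) < \<epsilon>" if "\<epsilon> > 0"
proof -
  obtain n where "\<bar>c\<bar> / \<epsilon> < 2 ^ n" using real_arch_pow[of 2] by auto
  moreover have "(2::real) ^ n \<le> real (M n)" using M_ge[of n] by (metis of_nat_le_iff of_nat_numeral of_nat_power)
  ultimately have "\<bar>c\<bar> / \<epsilon> < real (M n)" by linarith
  then have "\<bar>c\<bar> / real (M n) < \<epsilon>" using that M_pos[of n] by (simp add: field_simps)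
  moreover have "c / real (M n) \<le> \<bar>c\<bar> / real (M n)" by (simp add: divide_right_mono)
  ultimately show ?thesis by (intro exI[of _ n]) linarith
qed

lemma G_strict: "i < j \<Longrightarrow> j \<le> M n \<Longrightarrow> G n i < G n j"
proof (induction j)
  case (Suc j)
  have "G n j < G n (Suc j)" using Suc.prems by (intro G_step) simp
  moreover have "G n i \<le> G n j" using Suc by (cases "i = j") auto
  ultimately show ?case by simp
qed simp

lemma G_mono: "i \<le> j \<Longrightarrow> j \<le> M n \<Longrightarrow> G n i \<le> G n j"
  using G_strict[of i j n] by (cases "i = j") auto

lemma G_le_iff: "i \<le> M n \<Longrightarrow> j \<le> M n \<Longrightarrow> G n i \<le> G n j \<longleftrightarrow> i \<le> j"
  using G_strict[of j i n] G_mono[of i j n] by (meson leD leI)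

lemma G_unit: "i \<le> M n \<Longrightarrow> G n i \<in> {0..1}"
  using G_mono[of 0 i n] G_mono[of i "M n" n] by (simp add: G_first G_last)

lemma G_common:
  assumes "m \<le> n"
  shows "\<exists>q. M n = M m * q \<and> (\<forall>i\<le>M m. G n (i * q) = G m i)"
  using assms
proof (induction n rule: dec_induct)
  case base
  then show ?case by (intro exI[of _ 1]) simp
next
  case (step n)
  then obtain q where q: "M n = M m * q" "\<And>i. i \<le> M m \<Longrightarrow> G n (i * q) = G m i" by auto
  have "G (Suc n) (i * (q * N n)) = G m i" if "i \<le> M m" for i
    using that q G_refine[of "i * q" n] by (simp add: mult.assoc[symmetric])
  then show ?case using q(1) by (intro exI[of _ "q * N n"]) (simp add: M_Suc)
qed

lemma cell_exists:
  assumes "x \<in> {0..1}"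
  shows "\<exists>i<M n. G n i \<le> x \<and> x \<le> G n (Suc i)"
proof -
  have ex: "\<exists>j. j \<le> M n \<and> x \<le> G n j" using assms by (intro exI[of _ "M n"]) (simp add: G_last)
  define j where "j = (LEAST j. j \<le> M n \<and> x \<le> G n j)"
  have j: "j \<le> M n" "x \<le> G n j" using LeastI_ex[OF ex] by (auto simp: j_def)
  show ?thesis
  proof (cases j)
    case 0
    then have "x = 0" using j assms by (simp add: G_first)
    then show ?thesis using M_pos[of n] G_step[of 0 n] by (intro exI[of _ 0]) (auto simp: G_first)
  next
    case (Suc i)
    then have "\<not> (i \<le> M n \<and> x \<le> G n i)"
      using not_less_Least[of i "\<lambda>j. j \<le> M n \<and> x \<le> G n j"] unfolding j_def by simp
    then show ?thesis using j Suc by (intro exI[of _ i]) auto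
  qed
qed

lemma grid_near:
  assumes "x \<in> {0..1}" "\<epsilon> > 0"
  shows "\<exists>n0. \<forall>n\<ge>n0. \<exists>i\<le>M n. \<bar>G n i - x\<bar> < \<epsilon>"
proof -
  obtain n0 where n0: "\<And>n i. n \<ge> n0 \<Longrightarrow> i < M n \<Longrightarrow> G n (Suc i) - G n i < \<epsilon>"
    using mesh[OF assms(2)] by auto
  have "\<exists>i\<le>M n. \<bar>G n i - x\<bar> < \<epsilon>" if "n \<ge> n0" for n
  proof -
    obtain i where "i < M n" "G n i \<le> x" "x \<le> G n (Suc i)"
      using cell_exists[OF assms(1)] by blast
    then show ?thesis using n0[OF that, of i] by (intro exI[of _ i]) auto
  qed
  then show ?thesis by blast
qed

definition incr :: "nat \<Rightarrow> (real \<Rightarrow> real) \<Rightarrow> nat \<Rightarrow> real" where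
  "incr n f i = f (G n (Suc i)) - f (G n i)"

text \<open>
  In the coordinate in which each cell of level \<open>n\<close> has length \<open>1 / M n\<close>, this is the classical
  Dirichlet integral of the piecewise linear interpolations of \<open>f\<close> and \<open>g\<close>.
\<close>

definition energy :: "nat \<Rightarrow> (real \<Rightarrow> real) \<Rightarrow> (real \<Rightarrow> real) \<Rightarrow> real" where
  "energy n f g = real (M n) * (\<Sum>i<M n. incr n f i * incr n g i)"

lemma incr_cong:
  assumes "\<And>x. x \<in> {0..1} \<Longrightarrow> f x = f' x" "i < M n"
  shows "incr n f i = incr n f' i"
  using assms G_unit[of i n] G_unit[of "Suc i" n] by (simp add: incr_def)

lemma energy_cong:
  assumes "\<And>x. x \<in> {0..1} \<Longrightarrow> f x = f' x" "\<And>x. x \<in> {0..1} \<Longrightarrow> g x = g' x"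
  shows "energy n f g = energy n f' g'"
proof -
  have "(\<Sum>i<M n. incr n f i * incr n g i) = (\<Sum>i<M n. incr n f' i * incr n g' i)"
    using incr_cong[OF assms(1)] incr_cong[OF assms(2)] by (intro sum.cong) simp_all
  then show ?thesis by (simp add: energy_def)
qed

lemma energy_sym: "energy n f g = energy n g f"
  by (simp add: energy_def mult.commute)

lemma energy_add: "energy n (\<lambda>x. f x + g x) h = energy n f h + energy n g h"
proof -
  have "incr n (\<lambda>x. f x + g x) i * incr n h i = incr n f i * incr n h i + incr n g i * incr n h i" for i
    by (simp add: incr_def algebra_simps)
  then show ?thesis by (simp add: energy_def sum.distrib distrib_left)
qed

lemma energy_scale: "energy n (\<lambda>x. c * f x) h = c * energy n f h"
proof -
  have "incr n (\<lambda>x. c * f x) i * incr n h i = c * (incr n f i * incr n h i)" for i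
    by (simp add: incr_def algebra_simps)
  then show ?thesis by (simp only: energy_def sum_distrib_left[symmetric] mult.left_commute)
qed

lemma energy_diff: "energy n (\<lambda>x. f x - g x) h = energy n f h - energy n g h"
  using energy_add[of n f "\<lambda>x. (-1) * g x" h] energy_scale[of n "-1" g h] by simp

lemma energy_add_right: "energy n h (\<lambda>x. f x + g x) = energy n h f + energy n h g"
  using energy_add[of n f g h] by (simp add: energy_sym[of n h])

lemma energy_diff_right: "energy n h (\<lambda>x. f x - g x) = energy n h f - energy n h g"
  using energy_diff[of n f g h] by (simp add: energy_sym[of n h])

lemma energy_scale_right: "energy n h (\<lambda>x. c * f x) = c * energy n h f"
  using energy_scale[of n c f h] by (simp add: energy_sym[of n h])

lemma energy_nonneg: "0 \<le> energy n f f"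
  by (simp add: energy_def sum_nonneg)

lemma energy_eq_squares: "energy n f f = real (M n) * (\<Sum>i<M n. (incr n f i)\<^sup>2)"
  by (simp add: energy_def power2_eq_square)

lemma energy_parallelogram:
  "energy n (\<lambda>x. f x + g x) (\<lambda>x. f x + g x) + energy n (\<lambda>x. f x - g x) (\<lambda>x. f x - g x)
    = 2 * energy n f f + 2 * energy n g g"
  by (simp add: energy_add energy_diff energy_add_right energy_diff_right)

lemma energy_polarization:
  "energy n f g = (energy n (\<lambda>x. f x + g x) (\<lambda>x. f x + g x)
                   - energy n (\<lambda>x. f x - g x) (\<lambda>x. f x - g x)) / 4"
  using energy_sym[of n f g]
  by (simp add: energy_add energy_diff energy_add_right energy_diff_right)

lemma sum_incr: "i \<le> j \<Longrightarrow> (\<Sum>k=i..<j. incr n f k) = f (G n j) - f (G n i)"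
  using sum_Suc_diff'[of i j "\<lambda>k. f (G n k)"] by (simp add: incr_def)

text \<open>
  An increment over a cell is the sum of the increments over its \<open>N n\<close> children. Cauchy-Schwarz costs a
  factor \<open>N n\<close>, which is exactly the quotient of \<open>M (n+1)\<close> and \<open>M n\<close>.
\<close>

lemma energy_mono_Suc: "energy n f f \<le> energy (Suc n) f f"
proof -
  define N' where "N' = N n"
  have "(incr n f i)\<^sup>2 \<le> real N' * (\<Sum>k=i*N'..<i*N'+N'. (incr (Suc n) f k)\<^sup>2)" if i: "i < M n" for i
  proof -
    have "G (Suc n) (i*N') = G n i" "G (Suc n) (i*N'+N') = G n (Suc i)"
      using G_refine[of i n] G_refine[of "Suc i" n] i by (simp_all add: N'_def add.commute)
    then have "incr n f i = (\<Sum>k=i*N'..<i*N'+N'. incr (Suc n) f k)"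
      using sum_incr[of "i*N'" "i*N'+N'" "Suc n" f] by (simp add: incr_def[of n])
    then show ?thesis
      using sum_squared_le_sum_of_squares[of "incr (Suc n) f" "{i*N'..<i*N'+N'}"]
      by (simp add: mult.commute)
  qed
  then have "(\<Sum>i<M n. (incr n f i)\<^sup>2)
      \<le> (\<Sum>i<M n. real N' * (\<Sum>k=i*N'..<i*N'+N'. (incr (Suc n) f k)\<^sup>2))"
    by (intro sum_mono) simp
  also have "\<dots> = real N' * (\<Sum>k<M n * N'. (incr (Suc n) f k)\<^sup>2)"
    by (simp add: sum_distrib_left[symmetric] sum.nat_group)
  finally show ?thesis
    by (simp add: energy_eq_squares M_Suc N'_def mult.assoc mult_left_mono)
qed

lemma energy_mono: "m \<le> n \<Longrightarrow> energy m f f \<le> energy n f f"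
  using lift_Suc_mono_le[of "\<lambda>n. energy n f f"] energy_mono_Suc by blast

text \<open>
  The one-dimensional Sobolev inequality at level \<open>n\<close>.
\<close>

lemma incr_square_le_energy:
  assumes "i \<le> j" "j \<le> M n"
  shows "(f (G n j) - f (G n i))\<^sup>2 \<le> energy n f f"
proof -
  have "(f (G n j) - f (G n i))\<^sup>2 = (\<Sum>k=i..<j. incr n f k)\<^sup>2"
    using assms by (simp add: sum_incr)
  also have "\<dots> \<le> (\<Sum>k=i..<j. (incr n f k)\<^sup>2) * real (j - i)"
    using sum_squared_le_sum_of_squares[of "incr n f" "{i..<j}"] by simp
  also have "\<dots> \<le> (\<Sum>k<M n. (incr n f k)\<^sup>2) * real (M n)"
    using assms by (intro mult_mono sum_mono2 sum_nonneg) auto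
  finally show ?thesis by (simp add: energy_eq_squares mult.commute)
qed

definition finite_energy :: "(real \<Rightarrow> real) set" where
  "finite_energy = {h. continuous_on {0..1} h \<and> bdd_above (range (\<lambda>n. energy n h h))}"

text \<open>
  The limit exists for functions of finite energy (\<open>energy_tendsto\<close>); \<open>lim\<close> is
  unspecified for divergent sequences.
\<close>

definition total_energy :: "(real \<Rightarrow> real) \<Rightarrow> (real \<Rightarrow> real) \<Rightarrow> real" where
  "total_energy f g = lim (\<lambda>n. energy n f g)"

lemma finite_energyI:
  assumes "continuous_on {0..1} h" "\<And>n. energy n h h \<le> C"
  shows "h \<in> finite_energy"
  using assms(1) bdd_aboveI2[of UNIV "\<lambda>n. energy n h h" C] assms(2) by (simp add: finite_energy_def)

lemma finite_energy_continuous: "h \<in> finite_energy \<Longrightarrow> continuous_on {0..1} h"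
  by (simp add: finite_energy_def)

lemma energy_bounded: "h \<in> finite_energy \<Longrightarrow> \<exists>C. \<forall>n. energy n h h \<le> C"
  by (auto simp: finite_energy_def bdd_above_def)

lemma finite_energy_cong:
  assumes "\<And>x. x \<in> {0..1} \<Longrightarrow> f x = f' x"
  shows "f \<in> finite_energy \<longleftrightarrow> f' \<in> finite_energy"
proof -
  have "continuous_on {0..1} f \<longleftrightarrow> continuous_on {0..1} f'"
    using assms by (intro continuous_on_cong) auto
  moreover have "energy n f f = energy n f' f'" for n
    using assms by (intro energy_cong) auto
  ultimately show ?thesis by (simp add: finite_energy_def)
qed

lemma finite_energy_add_diff:
  assumes f: "f \<in> finite_energy" and g: "g \<in> finite_energy"
  shows "(\<lambda>x. f x + g x) \<in> finite_energy" "(\<lambda>x. f x - g x) \<in> finite_energy"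
proof -
  obtain A where A: "\<And>n. energy n f f \<le> A" using energy_bounded[OF f] by blast
  obtain B where B: "\<And>n. energy n g g \<le> B" using energy_bounded[OF g] by blast
  have "energy n (\<lambda>x. f x + g x) (\<lambda>x. f x + g x) \<le> 2 * A + 2 * B"
       "energy n (\<lambda>x. f x - g x) (\<lambda>x. f x - g x) \<le> 2 * A + 2 * B" for n
    using energy_parallelogram[of n f g] A[of n] B[of n]
      energy_nonneg[of n "\<lambda>x. f x + g x"] energy_nonneg[of n "\<lambda>x. f x - g x"] by linarith+
  then show "(\<lambda>x. f x + g x) \<in> finite_energy" "(\<lambda>x. f x - g x) \<in> finite_energy"
    using finite_energy_continuous[OF f] finite_energy_continuous[OF g]
    by (auto intro!: finite_energyI continuous_intros)
qed

lemma finite_energy_scale: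
  assumes f: "f \<in> finite_energy"
  shows "(\<lambda>x. c * f x) \<in> finite_energy"
proof -
  obtain A where A: "\<And>n. energy n f f \<le> A" using energy_bounded[OF f] by blast
  have "energy n (\<lambda>x. c * f x) (\<lambda>x. c * f x) \<le> c\<^sup>2 * A" for n
    using mult_left_mono[OF A[of n], of "c\<^sup>2"]
    by (simp add: energy_scale energy_scale_right power2_eq_square mult.assoc)
  then show ?thesis
    using finite_energy_continuous[OF f] by (auto intro!: finite_energyI continuous_intros)
qed

lemma energy_tendsto_self:
  assumes "f \<in> finite_energy"
  shows "(\<lambda>n. energy n f f) \<longlonglongrightarrow> total_energy f f"
proof -
  have "incseq (\<lambda>n. energy n f f)" by (simp add: incseq_def energy_mono)
  moreover obtain C where "\<And>n. energy n f f \<le> C" using energy_bounded[OF assms] by blast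
  ultimately have "convergent (\<lambda>n. energy n f f)"
    using incseq_convergent[of "\<lambda>n. energy n f f" C] convergentI by blast
  then show ?thesis unfolding total_energy_def by (rule convergent_LIMSEQ_iff[THEN iffD1])
qed

text \<open>
  On the diagonal the energies are increasing and bounded; the general case follows by polarization.
\<close>

lemma energy_tendsto:
  assumes "f \<in> finite_energy" "g \<in> finite_energy"
  shows "(\<lambda>n. energy n f g) \<longlonglongrightarrow> total_energy f g"
proof -
  have *: "(\<lambda>n. energy n f g) \<longlonglongrightarrow>
      (total_energy (\<lambda>x. f x + g x) (\<lambda>x. f x + g x) - total_energy (\<lambda>x. f x - g x) (\<lambda>x. f x - g x)) / 4"
    by (subst energy_polarization)
       (intro tendsto_intros energy_tendsto_self finite_energy_add_diff assms, simp)
  then have "convergent (\<lambda>n. energy n f g)" by (rule convergentI)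
  then show ?thesis unfolding total_energy_def by (rule convergent_LIMSEQ_iff[THEN iffD1])
qed

lemma energy_le_total: "f \<in> finite_energy \<Longrightarrow> energy n f f \<le> total_energy f f"
  by (rule incseq_le[OF _ energy_tendsto_self]) (simp_all add: incseq_def energy_mono)

lemma total_energy_nonneg: "f \<in> finite_energy \<Longrightarrow> 0 \<le> total_energy f f"
  using energy_le_total[of f 0] energy_nonneg[of 0 f] by simp

lemma total_energy_le: "f \<in> finite_energy \<Longrightarrow> (\<And>n. energy n f f \<le> C) \<Longrightarrow> total_energy f f \<le> C"
  using energy_tendsto_self by (rule LIMSEQ_le_const2) auto

lemma total_energy_eqI:
  assumes "(\<lambda>n. energy n f g) \<longlonglongrightarrow> L"
  shows "total_energy f g = L"
  unfolding total_energy_def using assms by (rule limI)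

lemma total_energy_add:
  assumes "f \<in> finite_energy" "g \<in> finite_energy" "h \<in> finite_energy"
  shows "total_energy (\<lambda>x. f x + g x) h = total_energy f h + total_energy g h"
  by (rule total_energy_eqI) (simp add: energy_add tendsto_add energy_tendsto assms)

lemma total_energy_scale:
  assumes "f \<in> finite_energy" "h \<in> finite_energy"
  shows "total_energy (\<lambda>x. c * f x) h = c * total_energy f h"
  by (rule total_energy_eqI) (simp add: energy_scale tendsto_mult_left energy_tendsto assms)

lemma total_energy_sym: "total_energy f g = total_energy g f"
  by (simp add: total_energy_def energy_sym)

lemma total_energy_cong:
  assumes "\<And>x. x \<in> {0..1} \<Longrightarrow> f x = f' x" "\<And>x. x \<in> {0..1} \<Longrightarrow> g x = g' x"
  shows "total_energy f g = total_energy f' g'"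
  unfolding total_energy_def using energy_cong[OF assms] by simp

text \<open>
  Energy controls the oscillation in the supremum norm. On grid points this is
  \<open>incr_square_le_energy\<close>; since the grids become dense, continuity extends it to all points.
\<close>

lemma oscillation_le_energy:
  assumes f: "f \<in> finite_energy" and x: "x \<in> {0..1}" and y: "y \<in> {0..1}"
  shows "(f x - f y)\<^sup>2 \<le> total_energy f f"
proof -
  have c: "continuous_on {0..1} f" using f by (rule finite_energy_continuous)
  have "\<bar>f x - f y\<bar> \<le> sqrt (total_energy f f)"
  proof (rule field_le_epsilon)
    fix e :: real assume e: "e > 0"
    obtain a where a: "a > 0" "\<And>z. z \<in> {0..1} \<Longrightarrow> \<bar>z - x\<bar> < a \<Longrightarrow> \<bar>f z - f x\<bar> < e/2"
      using c x e unfolding continuous_on_iff dist_real_def by (meson half_gt_zero)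
    obtain b where b: "b > 0" "\<And>z. z \<in> {0..1} \<Longrightarrow> \<bar>z - y\<bar> < b \<Longrightarrow> \<bar>f z - f y\<bar> < e/2"
      using c y e unfolding continuous_on_iff dist_real_def by (meson half_gt_zero)
    obtain n1 where n1: "\<And>n. n \<ge> n1 \<Longrightarrow> \<exists>i\<le>M n. \<bar>G n i - x\<bar> < a"
      using grid_near[OF x a(1)] by auto
    obtain n2 where n2: "\<And>n. n \<ge> n2 \<Longrightarrow> \<exists>i\<le>M n. \<bar>G n i - y\<bar> < b"
      using grid_near[OF y b(1)] by auto
    define n where "n = max n1 n2"
    obtain i j where i: "i \<le> M n" "\<bar>G n i - x\<bar> < a" and j: "j \<le> M n" "\<bar>G n j - y\<bar> < b"
      using n1[of n] n2[of n] by (auto simp: n_def)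
    have "(f (G n i) - f (G n j))\<^sup>2 \<le> energy n f f"
      using incr_square_le_energy[of i j n f] incr_square_le_energy[of j i n f] i j
      by (cases "i \<le> j") (auto simp: power2_commute)
    also have "\<dots> \<le> total_energy f f" using f by (rule energy_le_total)
    finally have "\<bar>f (G n i) - f (G n j)\<bar> \<le> sqrt (total_energy f f)"
      using real_le_rsqrt by (metis power2_abs)
    moreover have "\<bar>f (G n i) - f x\<bar> < e/2" "\<bar>f (G n j) - f y\<bar> < e/2"
      using a b i j G_unit by auto
    ultimately show "\<bar>f x - f y\<bar> \<le> sqrt (total_energy f f) + e" by linarith
  qed
  then show ?thesis
    using total_energy_nonneg[OF f] by (metis abs_ge_zero power2_abs power_mono real_sqrt_pow2)
qed

text \<open>
  Write \<open>f x = f y + (f x - f y)\<close> and average over \<open>y\<close>.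
\<close>

lemma square_le_L2_energy:
  assumes f: "f \<in> finite_energy" and x: "x \<in> {0..1}"
  shows "(f x)\<^sup>2 \<le> 2 * (\<integral>y. (f y)\<^sup>2 \<partial>unit_lebesgue) + 2 * total_energy f f"
proof -
  interpret finite_measure unit_lebesgue by (rule finite_measure_unit_lebesgue)
  have m: "measure unit_lebesgue {0..1} = 1"
    using emeasure_unit_lebesgue_total by (simp add: emeasure_eq_measure)
  have i: "integrable unit_lebesgue (\<lambda>y. (f y)\<^sup>2)"
    using continuous_L2_unit[OF finite_energy_continuous[OF f]] by (simp add: L2_def)
  have "(f x)\<^sup>2 \<le> 2 * (f y)\<^sup>2 + 2 * total_energy f f" if "y \<in> {0..1}" for y
    using square_add_le[of "f y" "f x - f y"] oscillation_le_energy[OF f x that] by simp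
  then have "(\<integral>y. (f x)\<^sup>2 \<partial>unit_lebesgue) \<le> (\<integral>y. 2 * (f y)\<^sup>2 + 2 * total_energy f f \<partial>unit_lebesgue)"
    using i by (intro integral_mono) simp_all
  also have "\<dots> = 2 * (\<integral>y. (f y)\<^sup>2 \<partial>unit_lebesgue) + 2 * total_energy f f"
    using i m by simp
  finally show ?thesis using m by simp
qed

section \<open>Completeness, Markov property and locality of the energy\<close>

definition energy_norm2 :: "(real \<Rightarrow> real) \<Rightarrow> real" where
  "energy_norm2 f = (\<integral>x. (f x)\<^sup>2 \<partial>unit_lebesgue) + total_energy f f"

lemma energy_norm2_bounds:
  assumes f: "f \<in> finite_energy"
  shows "0 \<le> energy_norm2 f" "total_energy f f \<le> energy_norm2 f"
    "x \<in> {0..1} \<Longrightarrow> (f x)\<^sup>2 \<le> 2 * energy_norm2 f"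
  using total_energy_nonneg[OF f] square_le_L2_energy[OF f]
  by (simp_all add: energy_norm2_def)

text \<open>
  By \<open>square_le_L2_energy\<close> a Cauchy sequence is uniformly Cauchy, hence has a continuous limit \<open>g\<close>. Each
  discrete energy is a finite sum and passes to the pointwise limit, so bounds that hold for
  \<open>h m - h n\<close> with all large \<open>n\<close> hold for \<open>h m - g\<close>, uniformly in the level of the grid.
\<close>

lemma finite_energy_complete:
  assumes h: "\<And>n. h n \<in> finite_energy"
    and Cauchy: "\<And>\<epsilon>. \<epsilon> > 0 \<Longrightarrow> \<exists>K. \<forall>m\<ge>K. \<forall>n\<ge>K. energy_norm2 (\<lambda>x. h m x - h n x) < \<epsilon>"
  shows "\<exists>g\<in>finite_energy. (\<lambda>n. energy_norm2 (\<lambda>x. h n x - g x)) \<longlonglongrightarrow> 0"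
proof -
  have hd: "(\<lambda>x. h m x - h n x) \<in> finite_energy" for m n
    by (intro finite_energy_add_diff h)
  have "uniformly_Cauchy_on {0..1} h"
    unfolding uniformly_Cauchy_on_def
  proof (intro allI impI)
    fix e :: real assume e: "e > 0"
    then obtain K where K: "\<And>m n. m \<ge> K \<Longrightarrow> n \<ge> K \<Longrightarrow> energy_norm2 (\<lambda>x. h m x - h n x) < e\<^sup>2 / 2"
      using Cauchy[of "e\<^sup>2 / 2"] by auto
    have "dist (h m x) (h n x) < e" if "x \<in> {0..1}" "m \<ge> K" "n \<ge> K" for x m n
    proof -
      have "(h m x - h n x)\<^sup>2 < e\<^sup>2"
        using energy_norm2_bounds(3)[OF hd[of m n] that(1)] K[OF that(2,3)] by simp
      then have "\<bar>h m x - h n x\<bar> < e"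
        using e power2_less_imp_less[of "\<bar>h m x - h n x\<bar>" e] by simp
      then show ?thesis by (simp add: dist_real_def)
    qed
    then show "\<exists>K. \<forall>x\<in>{0..1}. \<forall>m\<ge>K. \<forall>n\<ge>K. dist (h m x) (h n x) < e" by blast
  qed
  then obtain g where g: "uniform_limit {0..1} h g sequentially"
    using Cauchy_uniformly_convergent by (auto simp: uniformly_convergent_on_def)
  have gc: "continuous_on {0..1} g"
    using finite_energy_continuous[OF h] by (intro uniform_limit_theorem[OF _ g]) auto
  have lim: "(\<lambda>n. h n x) \<longlonglongrightarrow> g x" if "x \<in> {0..1}" for x
    using tendsto_uniform_limitI[OF g that] .
  have lim_energy: "(\<lambda>n. energy k (\<lambda>x. h m x - h n x) (\<lambda>x. h m x - h n x))
      \<longlonglongrightarrow> energy k (\<lambda>x. h m x - g x) (\<lambda>x. h m x - g x)" for k m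
    unfolding energy_def incr_def
    by (intro tendsto_intros lim G_unit) auto
  \<comment> \<open>\<open>3 * e\<close>: the squared supremum contributes \<open>2 * e\<close> to the integral and the energy contributes \<open>e\<close>\<close>
  have bound: "(\<lambda>x. h m x - g x) \<in> finite_energy \<and> energy_norm2 (\<lambda>x. h m x - g x) \<le> 3 * e"
    if e: "e > 0" and K: "\<And>m n. m \<ge> K \<Longrightarrow> n \<ge> K \<Longrightarrow> energy_norm2 (\<lambda>x. h m x - h n x) < e" and m: "m \<ge> K"
    for e K m
  proof -
    interpret finite_measure unit_lebesgue by (rule finite_measure_unit_lebesgue)
    have m1: "measure unit_lebesgue {0..1} = 1"
      using emeasure_unit_lebesgue_total by (simp add: emeasure_eq_measure)
    have en: "energy k (\<lambda>x. h m x - g x) (\<lambda>x. h m x - g x) \<le> e" for k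
    proof (rule LIMSEQ_le_const2[OF lim_energy], intro exI allI impI)
      fix n assume "n \<ge> K"
      then show "energy k (\<lambda>x. h m x - h n x) (\<lambda>x. h m x - h n x) \<le> e"
        using energy_le_total[OF hd[of m n], of k] energy_norm2_bounds(2)[OF hd[of m n]] K[OF m, of n]
        by linarith
    qed
    have fe: "(\<lambda>x. h m x - g x) \<in> finite_energy"
      using finite_energy_continuous[OF h] gc en by (intro finite_energyI[of _ e] continuous_intros) auto
    have sq: "(h m x - g x)\<^sup>2 \<le> 2 * e" if x: "x \<in> {0..1}" for x
    proof (rule LIMSEQ_le_const2[OF tendsto_power[OF tendsto_diff[OF tendsto_const lim[OF x]]]],
        intro exI allI impI)
      fix n assume "n \<ge> K"
      then show "(h m x - h n x)\<^sup>2 \<le> 2 * e"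
        using energy_norm2_bounds(3)[OF hd[of m n] x] K[OF m, of n] by linarith
    qed
    have "(\<integral>x. (h m x - g x)\<^sup>2 \<partial>unit_lebesgue) \<le> (\<integral>x. 2 * e \<partial>unit_lebesgue)"
      using continuous_L2_unit[OF finite_energy_continuous[OF fe]] sq
      by (intro integral_mono) (simp_all add: L2_def)
    then have "energy_norm2 (\<lambda>x. h m x - g x) \<le> 3 * e"
      using total_energy_le[OF fe en] m1 by (simp add: energy_norm2_def)
    then show ?thesis using fe by blast
  qed
  have lim0: "\<exists>K. \<forall>m\<ge>K. (\<lambda>x. h m x - g x) \<in> finite_energy \<and> energy_norm2 (\<lambda>x. h m x - g x) < e"
    if "e > 0" for e
  proof -
    obtain K where "\<And>m n. m \<ge> K \<Longrightarrow> n \<ge> K \<Longrightarrow> energy_norm2 (\<lambda>x. h m x - h n x) < e / 4"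
      using Cauchy[of "e / 4"] \<open>e > 0\<close> by auto
    then have "(\<lambda>x. h m x - g x) \<in> finite_energy \<and> energy_norm2 (\<lambda>x. h m x - g x) \<le> 3 * (e / 4)"
      if "m \<ge> K" for m
      using bound[of "e / 4" K m] \<open>e > 0\<close> that by simp
    then show ?thesis using \<open>e > 0\<close> by (intro exI[of _ K]) force
  qed
  obtain K where "(\<lambda>x. h K x - g x) \<in> finite_energy" using lim0[of 1] by auto
  then have "(\<lambda>x. h K x - (h K x - g x)) \<in> finite_energy"
    by (rule finite_energy_add_diff(2)[OF h])
  then have gfe: "g \<in> finite_energy" by (simp add: diff_diff_eq2)
  moreover have "(\<lambda>n. energy_norm2 (\<lambda>x. h n x - g x)) \<longlonglongrightarrow> 0"
  proof (rule LIMSEQ_I)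
    fix r :: real assume "r > 0"
    then obtain K where "\<And>m. m \<ge> K \<Longrightarrow> energy_norm2 (\<lambda>x. h m x - g x) < r" using lim0 by blast
    moreover have "0 \<le> energy_norm2 (\<lambda>x. h m x - g x)" for m
      by (intro energy_norm2_bounds finite_energy_add_diff h gfe)
    ultimately show "\<exists>no. \<forall>n\<ge>no. norm (energy_norm2 (\<lambda>x. h n x - g x) - 0) < r"
      by (intro exI[of _ K]) simp
  qed
  ultimately show ?thesis by blast
qed

text \<open>
  Truncation to \<open>[0, 1]\<close> is 1-Lipschitz and so shrinks every increment.
\<close>

lemma unit_contraction_energy:
  assumes f: "f \<in> finite_energy"
  shows "(\<lambda>x. min (max (f x) 0) 1) \<in> finite_energy"
    "total_energy (\<lambda>x. min (max (f x) 0) 1) (\<lambda>x. min (max (f x) 0) 1) \<le> total_energy f f"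
proof -
  let ?c = "\<lambda>x. min (max (f x) 0) 1"
  have "(incr n ?c i)\<^sup>2 \<le> (incr n f i)\<^sup>2" for n i
    unfolding incr_def abs_le_square_iff[symmetric] by linarith
  then have "energy n ?c ?c \<le> energy n f f" for n
    unfolding energy_eq_squares by (intro mult_left_mono sum_mono) auto
  then have le: "energy n ?c ?c \<le> total_energy f f" for n
    using energy_le_total[OF f, of n] order_trans by blast
  show fe: "?c \<in> finite_energy"
    using finite_energy_continuous[OF f] le by (intro finite_energyI continuous_intros) auto
  show "total_energy ?c ?c \<le> total_energy f f"
    using fe le by (rule total_energy_le)
qed

text \<open>
  As \<open>S\<close> is compact, it has a positive distance to the complement of \<open>U\<close>. Once the mesh is below this
  distance, a cell with an endpoint in \<open>S\<close> has both endpoints in \<open>U\<close>, where \<open>f\<close> is constant, and on all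
  other cells the increment of \<open>g\<close> vanishes. So the discrete energies are eventually \<open>0\<close>.
\<close>

lemma total_energy_local:
  assumes U: "openin (top_of_set {0..1}) U" and S: "compact S" "S \<subseteq> U"
    and f: "\<And>x. x \<in> U \<Longrightarrow> f x = c" and g: "\<And>x. x \<in> {0..1} \<Longrightarrow> x \<notin> S \<Longrightarrow> g x = 0"
  shows "total_energy f g = 0"
proof -
  obtain T where T: "open T" "U = {0..1} \<inter> T" using U by (auto simp: openin_open)
  obtain r where r: "r > 0" "(\<Union>x\<in>S. ball x r) \<subseteq> T"
    using compact_subset_open_imp_ball_epsilon_subset[of S T] S T by auto
  have SU: "y \<in> U" if "x \<in> S" "y \<in> {0..1}" "\<bar>x - y\<bar> < r" for x y
    using that r(2) T(2) by (force simp: dist_real_def)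
  obtain n0 where n0: "\<And>n i. n \<ge> n0 \<Longrightarrow> i < M n \<Longrightarrow> G n (Suc i) - G n i < r"
    using mesh[OF r(1)] by auto
  have "incr n f i * incr n g i = 0" if n: "n \<ge> n0" and i: "i < M n" for n i
  proof -
    define a b where "a = G n i" and "b = G n (Suc i)"
    have ab: "a \<in> {0..1}" "b \<in> {0..1}" using i G_unit[of i n] G_unit[of "Suc i" n] by (auto simp: a_def b_def)
    have near: "\<bar>a - b\<bar> < r" "\<bar>b - a\<bar> < r" using n0[OF n i] G_step[OF i] by (auto simp: a_def b_def)
    consider "a \<in> S" | "b \<in> S" | "a \<notin> S" "b \<notin> S" by blast
    then show ?thesis
    proof cases
      case 1
      then have "f a = c" "f b = c" using S(2) SU[OF 1 ab(2) near(1)] f by auto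
      then show ?thesis by (simp add: incr_def a_def b_def)
    next
      case 2
      then have "f b = c" "f a = c" using S(2) SU[OF 2 ab(1) near(2)] f by auto
      then show ?thesis by (simp add: incr_def a_def b_def)
    next
      case 3
      then have "g a = 0" "g b = 0" using g ab by auto
      then show ?thesis by (simp add: incr_def a_def b_def)
    qed
  qed
  then have "(\<Sum>i<M n. incr n f i * incr n g i) = 0" if "n \<ge> n0" for n
    using that by (intro sum.neutral) blast
  then have "\<forall>\<^sub>F n in sequentially. energy n f g = 0"
    unfolding eventually_sequentially by (intro exI[of _ n0]) (simp add: energy_def)
  then have "(\<lambda>n. energy n f g) \<longlonglongrightarrow> 0" by (rule tendsto_eventually)
  then show ?thesis by (rule total_energy_eqI)
qed

section \<open>The scale function and density of functions of finite energy\<close>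

text \<open>
  The scale function of the form: the increasing function that gives each cell of level \<open>n\<close> the length
  \<open>1 / M n\<close> (\<open>coordinate_grid\<close>). The supremum extends it from the grid points to the interval.
\<close>

definition coordinate :: "real \<Rightarrow> real" where
  "coordinate x = Sup {real i / real (M n) | n i. i \<le> M n \<and> G n i \<le> x}"

lemma grid_order:
  assumes "i \<le> M m" "j \<le> M n" "G m i \<le> G n j"
  shows "real i / real (M m) \<le> real j / real (M n)"
proof -
  define l where "l = max m n"
  obtain q where q: "M l = M m * q" "\<And>i. i \<le> M m \<Longrightarrow> G l (i * q) = G m i"
    using G_common[of m l] by (auto simp: l_def)
  obtain r where r: "M l = M n * r" "\<And>i. i \<le> M n \<Longrightarrow> G l (i * r) = G n i"
    using G_common[of n l] by (auto simp: l_def)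
  have pos: "q > 0" "r > 0" using q(1) r(1) M_pos[of l] by (metis gr0I less_numeral_extra(3) mult_0_right)+
  have "G l (i * q) \<le> G l (j * r)" using q(2) r(2) assms by simp
  moreover have "i * q \<le> M l" by (subst q(1), rule mult_le_mono1[OF assms(1)])
  moreover have "j * r \<le> M l" by (subst r(1), rule mult_le_mono1[OF assms(2)])
  ultimately have "i * q \<le> j * r" using G_le_iff by blast
  then have "real (i * q) / real (M l) \<le> real (j * r) / real (M l)"
    by (intro divide_right_mono) (simp_all only: of_nat_le_iff of_nat_0_le_iff)
  moreover have "real (i * q) / real (M l) = real i / real (M m)" using q(1) pos by simp
  moreover have "real (j * r) / real (M l) = real j / real (M n)" using r(1) pos by simp
  ultimately show ?thesis by simp
qed

lemma coordinate_grid: "i \<le> M n \<Longrightarrow> coordinate (G n i) = real i / real (M n)"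
  unfolding coordinate_def by (rule cSup_eq_maximum) (auto intro: grid_order)

lemma coordinate_mono:
  assumes "0 \<le> x" "x \<le> y"
  shows "coordinate x \<le> coordinate y"
  unfolding coordinate_def
proof (rule cSup_subset_mono)
  show "{real i / real (M n) | n i. i \<le> M n \<and> G n i \<le> x} \<noteq> {}"
  proof -
    have "real 0 / real (M 0) \<in> {real i / real (M n) | n i. i \<le> M n \<and> G n i \<le> x}"
      using assms G_first[of 0] by (intro CollectI exI[of _ 0] conjI refl) auto
    then show ?thesis by blast
  qed
  show "bdd_above {real i / real (M n) | n i. i \<le> M n \<and> G n i \<le> y}"
    by (intro bdd_aboveI[of _ 1]) (auto simp: divide_le_eq_1 M_pos)
  show "{real i / real (M n) | n i. i \<le> M n \<and> G n i \<le> x}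
      \<subseteq> {real i / real (M n) | n i. i \<le> M n \<and> G n i \<le> y}"
    using assms by force
qed

text \<open>
  If no complete cell fits between \<open>x\<close> and \<open>y\<close>, then both lie in the union of two adjacent cells, and
  the coordinate increases by at most \<open>2 / M n\<close> there. Continuity and Hoelder continuity of the
  coordinate both rest on this.
\<close>

lemma full_cell_between:
  assumes x: "0 \<le> x" and xy: "x \<le> y" and y: "y \<le> 1"
    and gap: "2 / real (M n) < coordinate y - coordinate x"
  shows "\<exists>i<M n. x \<le> G n i \<and> G n (Suc i) \<le> y"
proof (rule ccontr)
  assume no: "\<not> ?thesis"
  obtain i where i: "i < M n" "G n i \<le> x" "x \<le> G n (Suc i)"
    using cell_exists[of x n] x xy y by auto
  have lo: "real i / real (M n) \<le> coordinate x"
    using coordinate_mono[of "G n i" x] coordinate_grid[of i n] G_unit[of i n] i by simp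
  have up: "coordinate y \<le> real (i + 2) / real (M n)"
  proof (cases "Suc i < M n")
    case True
    then have "y < G n (Suc (Suc i))" using no i by (meson not_less)
    then show ?thesis
      using coordinate_mono[of y "G n (Suc (Suc i))"] coordinate_grid[of "Suc (Suc i)" n] True x xy
      by simp
  next
    case False
    then have "Suc i = M n" using i by simp
    then have "coordinate y \<le> real (Suc i) / real (M n)"
      using coordinate_mono[of y "G n (M n)"] coordinate_grid[of "M n" n] G_last[of n] x xy y by simp
    also have "\<dots> \<le> real (i + 2) / real (M n)" by (intro divide_right_mono) auto
    finally show ?thesis .
  qed
  have "real (i + 2) / real (M n) = real i / real (M n) + 2 / real (M n)"
    by (simp add: add_divide_distrib)
  then show False using lo up gap by linarith
qed

text \<open>
  Points that are closer than the shortest cell of level \<open>n\<close> have no complete cell between them.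
\<close>

lemma coordinate_continuous: "continuous_on {0..1} coordinate"
  unfolding continuous_on_iff dist_real_def
proof (intro ballI allI impI)
  fix x e :: real assume x: "x \<in> {0..1}" and e: "e > 0"
  obtain n where n: "2 / real (M n) < e" using M_eventually_large[OF e] by blast
  define c where "c = Min ((\<lambda>i. G n (Suc i) - G n i) ` {..<M n})"
  have c: "c \<le> G n (Suc i) - G n i" if "i < M n" for i
    unfolding c_def using that by (intro Min_le) auto
  have "c \<in> (\<lambda>i. G n (Suc i) - G n i) ` {..<M n}"
    unfolding c_def using M_pos[of n] by (intro Min_in) auto
  then have c0: "c > 0" using G_step by auto
  have close: "coordinate v - coordinate u \<le> 2 / real (M n)"
    if "0 \<le> u" "u \<le> v" "v \<le> 1" "v - u < c" for u v
    using full_cell_between[of u v n] that c by force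
  have "\<bar>coordinate y - coordinate x\<bar> < e" if y: "y \<in> {0..1}" "\<bar>y - x\<bar> < c" for y
    using close[of x y] close[of y x] coordinate_mono[of x y] coordinate_mono[of y x] x y n
    by (cases "x \<le> y") auto
  then show "\<exists>d>0. \<forall>y\<in>{0..1}. \<bar>y - x\<bar> < d \<longrightarrow> \<bar>coordinate y - coordinate x\<bar> < e"
    using c0 by blast
qed

lemma coordinate_strict:
  assumes x: "0 \<le> x" and xy: "x < y" and y: "y \<le> 1"
  shows "coordinate x < coordinate y"
proof -
  obtain n where n: "\<And>i. i < M n \<Longrightarrow> G n (Suc i) - G n i < (y - x) / 2"
    using mesh[of "(y - x) / 2"] xy by auto
  obtain i where i: "i < M n" "G n i \<le> x" "x \<le> G n (Suc i)"
    using cell_exists[of x n] x xy y by auto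
  have "Suc i < M n"
  proof (rule ccontr)
    assume "\<not> Suc i < M n"
    then have "G n (Suc i) = 1" using i(1) G_last[of n] by (metis Suc_lessI)
    then show False using n[OF i(1)] i(2) xy y by (simp add: field_simps)
  qed
  then have i2: "G n (Suc (Suc i)) \<le> y" "Suc (Suc i) \<le> M n"
    using n[of i] n[of "Suc i"] i by auto
  have "coordinate x \<le> coordinate (G n (Suc i))" using i x by (intro coordinate_mono) auto
  also have "\<dots> < coordinate (G n (Suc (Suc i)))"
    using i2(2) M_pos[of n] by (simp add: coordinate_grid divide_strict_right_mono)
  also have "\<dots> \<le> coordinate y"
    using i2 G_unit[of "Suc (Suc i)" n] by (intro coordinate_mono) auto
  finally show ?thesis .
qed

text \<open>
  Each of the \<open>M n\<close> increments of level \<open>n\<close> is at most \<open>K / M n\<close>, so every discrete energy is at most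
  \<open>K\<^sup>2\<close>.
\<close>

lemma coordinate_Lipschitz_finite_energy:
  assumes c: "continuous_on {0..1} f"
    and K: "\<And>x y. x \<in> {0..1} \<Longrightarrow> y \<in> {0..1} \<Longrightarrow> \<bar>f x - f y\<bar> \<le> K * \<bar>coordinate x - coordinate y\<bar>"
  shows "f \<in> finite_energy"
proof (rule finite_energyI[OF c])
  fix n
  have "(incr n f i)\<^sup>2 \<le> (K / real (M n))\<^sup>2" if i: "i < M n" for i
  proof -
    have "\<bar>incr n f i\<bar> \<le> K * \<bar>coordinate (G n (Suc i)) - coordinate (G n i)\<bar>"
      unfolding incr_def using i G_unit by (intro K) auto
    also have "\<dots> = K * (1 / real (M n))"
      using i by (simp add: coordinate_grid diff_divide_distrib[symmetric])
    also have "\<dots> = K / real (M n)" by simp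
    also have "\<dots> \<le> \<bar>K / real (M n)\<bar>" by (rule abs_ge_self)
    finally have "\<bar>incr n f i\<bar> \<le> \<bar>K / real (M n)\<bar>" .
    then show ?thesis by (simp only: abs_le_square_iff)
  qed
  then have "(\<Sum>i<M n. (incr n f i)\<^sup>2) \<le> (\<Sum>i<M n. (K / real (M n))\<^sup>2)"
    by (intro sum_mono) auto
  then have "energy n f f \<le> real (M n) * (\<Sum>i<M n. (K / real (M n))\<^sup>2)"
    unfolding energy_eq_squares by (intro mult_left_mono) auto
  also have "\<dots> = K\<^sup>2" using M_pos[of n] by (simp add: power2_eq_square)
  finally show "energy n f f \<le> K\<^sup>2" .
qed

text \<open>
  Stone-Weierstrass for the functions that are Lipschitz in the coordinate: they form an algebra, and
  the coordinate itself separates points because it is strictly increasing.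
\<close>

lemma finite_energy_dense:
  assumes "continuous_on {0..1} f" "e > 0"
  shows "\<exists>g\<in>finite_energy. \<forall>x\<in>{0..1}. \<bar>f x - g x\<bar> < e"
proof -
  define P where "P f \<longleftrightarrow> continuous_on {0..1} f \<and>
    (\<exists>K. \<forall>x\<in>{0..1}. \<forall>y\<in>{0..1}. \<bar>f x - f y\<bar> \<le> K * \<bar>coordinate x - coordinate y\<bar>)" for f :: "real \<Rightarrow> real"
  have PI: "P f" if "continuous_on {0..1} f"
    "\<And>x y. x \<in> {0..1} \<Longrightarrow> y \<in> {0..1} \<Longrightarrow> \<bar>f x - f y\<bar> \<le> K * \<bar>coordinate x - coordinate y\<bar>" for f K
    using that unfolding P_def by blast
  have PD: "\<exists>K. \<forall>x\<in>{0..1}. \<forall>y\<in>{0..1}. \<bar>f x - f y\<bar> \<le> K * \<bar>coordinate x - coordinate y\<bar>"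
    if "P f" for f
    using that by (simp add: P_def)
  have "\<exists>g. P g \<and> (\<forall>x\<in>{0..1}. \<bar>f x - g x\<bar> < e)"
  proof (rule Stone_Weierstrass_HOL)
    show "compact {0..1::real}" by simp
    show "P (\<lambda>x. c)" for c by (rule PI[of _ 0]) auto
    show "continuous_on {0..1} f" if "P f" for f using that by (simp add: P_def)
    show "\<exists>f. P f \<and> f x \<noteq> f y" if "x \<in> {0..1} \<and> y \<in> {0..1} \<and> x \<noteq> y" for x y
    proof (intro exI[of _ coordinate] conjI)
      show "P coordinate" by (rule PI[of _ 1]) (auto intro: coordinate_continuous)
      show "coordinate x \<noteq> coordinate y"
        using that coordinate_strict[of x y] coordinate_strict[of y x] by (cases x y rule: linorder_cases) auto
    qed
    show "P (\<lambda>x. f x + g x)" if "P f \<and> P g" for f g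
    proof -
      obtain K where "\<forall>x\<in>{0..1}. \<forall>y\<in>{0..1}. \<bar>f x - f y\<bar> \<le> K * \<bar>coordinate x - coordinate y\<bar>"
        using PD[of f] \<open>P f \<and> P g\<close> by blast
      note K = this[rule_format]
      obtain L where "\<forall>x\<in>{0..1}. \<forall>y\<in>{0..1}. \<bar>g x - g y\<bar> \<le> L * \<bar>coordinate x - coordinate y\<bar>"
        using PD[of g] \<open>P f \<and> P g\<close> by blast
      note L = this[rule_format]
      show ?thesis
      proof (rule PI[of _ "K + L"])
        show "continuous_on {0..1} (\<lambda>x. f x + g x)" using that by (auto simp: P_def intro: continuous_intros)
        show "\<bar>f x + g x - (f y + g y)\<bar> \<le> (K + L) * \<bar>coordinate x - coordinate y\<bar>"
          if "x \<in> {0..1}" "y \<in> {0..1}" for x y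
          unfolding distrib_right using K[OF that] L[OF that] by linarith
      qed
    qed
    show "P (\<lambda>x. f x * g x)" if "P f \<and> P g" for f g
    proof -
      have c: "continuous_on {0..1} f" "continuous_on {0..1} g" using that by (auto simp: P_def)
      obtain K where "\<forall>x\<in>{0..1}. \<forall>y\<in>{0..1}. \<bar>f x - f y\<bar> \<le> K * \<bar>coordinate x - coordinate y\<bar>"
        using PD[of f] \<open>P f \<and> P g\<close> by blast
      note K = this[rule_format]
      obtain L where "\<forall>x\<in>{0..1}. \<forall>y\<in>{0..1}. \<bar>g x - g y\<bar> \<le> L * \<bar>coordinate x - coordinate y\<bar>"
        using PD[of g] \<open>P f \<and> P g\<close> by blast
      note L = this[rule_format]
      have "bounded (f ` {0..1})" "bounded (g ` {0..1})"
        using c by (auto intro!: compact_imp_bounded compact_continuous_image)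
      then obtain A B where A: "\<And>x. x \<in> {0..1} \<Longrightarrow> \<bar>f x\<bar> \<le> A" and B: "\<And>x. x \<in> {0..1} \<Longrightarrow> \<bar>g x\<bar> \<le> B"
        unfolding bounded_iff by (metis imageI real_norm_def)
      show ?thesis
      proof (rule PI[of _ "A * L + B * K"])
        show "continuous_on {0..1} (\<lambda>x. f x * g x)" using c by (intro continuous_intros)
        fix x y :: real assume xy: "x \<in> {0..1}" "y \<in> {0..1}"
        have "f x * g x - f y * g y = f x * (g x - g y) + g y * (f x - f y)" by (simp add: algebra_simps)
        then have "\<bar>f x * g x - f y * g y\<bar> \<le> \<bar>f x\<bar> * \<bar>g x - g y\<bar> + \<bar>g y\<bar> * \<bar>f x - f y\<bar>"
          using abs_triangle_ineq[of "f x * (g x - g y)" "g y * (f x - f y)"] by (simp add: abs_mult)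
        also have "\<dots> \<le> A * (L * \<bar>coordinate x - coordinate y\<bar>) + B * (K * \<bar>coordinate x - coordinate y\<bar>)"
          using A[OF xy(1)] B[OF xy(2)] K[OF xy] L[OF xy]
          by (intro add_mono mult_mono) (auto intro: order_trans[OF abs_ge_zero])
        finally show "\<bar>f x * g x - f y * g y\<bar> \<le> (A * L + B * K) * \<bar>coordinate x - coordinate y\<bar>"
          by (simp add: algebra_simps)
      qed
    qed
  qed (use assms in auto)
  then obtain g where g: "P g" "\<forall>x\<in>{0..1}. \<bar>f x - g x\<bar> < e" by blast
  obtain K where "\<forall>x\<in>{0..1}. \<forall>y\<in>{0..1}. \<bar>g x - g y\<bar> \<le> K * \<bar>coordinate x - coordinate y\<bar>"
    using PD[OF g(1)] by blast
  then have "g \<in> finite_energy"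
    using g(1) by (intro coordinate_Lipschitz_finite_energy[of g K]) (auto simp: P_def)
  then show ?thesis using g(2) by blast
qed

section \<open>The Dirichlet form of a refining grid\<close>

definition form_domain :: "(real \<Rightarrow> real) set" where
  "form_domain = {f \<in> borel_measurable unit_lebesgue.
     \<exists>h\<in>finite_energy. AE x in unit_lebesgue. f x = h x}"

text \<open>
  By full support two continuous functions that agree almost everywhere agree on the interval, so the
  choice is unique there (\<open>continuous_version_eq\<close>).
\<close>

definition continuous_version :: "(real \<Rightarrow> real) \<Rightarrow> real \<Rightarrow> real" where
  "continuous_version f = (SOME h. h \<in> finite_energy \<and> (AE x in unit_lebesgue. f x = h x))"

definition form :: "(real \<Rightarrow> real) \<Rightarrow> (real \<Rightarrow> real) \<Rightarrow> real" where
  "form f g = total_energy (continuous_version f) (continuous_version g)"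

lemma form_domainE:
  assumes "f \<in> form_domain"
  obtains h where "h \<in> finite_energy" "AE x in unit_lebesgue. f x = h x"
  using assms by (auto simp: form_domain_def)

lemma form_domainI:
  "f \<in> borel_measurable unit_lebesgue \<Longrightarrow> h \<in> finite_energy \<Longrightarrow> AE x in unit_lebesgue. f x = h x
    \<Longrightarrow> f \<in> form_domain"
  by (auto simp: form_domain_def)

lemma form_domain_measurable: "f \<in> form_domain \<Longrightarrow> f \<in> borel_measurable unit_lebesgue"
  by (simp add: form_domain_def)

lemma finite_energy_in_domain: "h \<in> finite_energy \<Longrightarrow> h \<in> form_domain"
  by (intro form_domainI[of h h] continuous_measurable_unit finite_energy_continuous) auto

lemma finite_energy_AE_unique:
  assumes "h \<in> finite_energy" "k \<in> finite_energy"
    "AE x in unit_lebesgue. f x = h x" "AE x in unit_lebesgue. f x = k x" "x \<in> {0..1}"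
  shows "h x = k x"
proof (rule continuous_AE_eq_unit[OF _ _ _ assms(5)])
  show "AE x in unit_lebesgue. h x = k x" using assms(3,4) by eventually_elim simp
qed (use assms finite_energy_continuous in auto)

lemma continuous_version_eq:
  assumes "h \<in> finite_energy" "AE x in unit_lebesgue. f x = h x" "x \<in> {0..1}"
  shows "continuous_version f x = h x"
proof -
  have "continuous_version f \<in> finite_energy \<and> (AE x in unit_lebesgue. f x = continuous_version f x)"
    unfolding continuous_version_def by (rule someI[of _ h]) (use assms in blast)
  then show ?thesis using finite_energy_AE_unique[of "continuous_version f" h f x] assms by blast
qed

lemma form_eq:
  assumes "h \<in> finite_energy" "AE x in unit_lebesgue. f x = h x"
    "k \<in> finite_energy" "AE x in unit_lebesgue. g x = k x"
  shows "form f g = total_energy h k"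
  unfolding form_def by (rule total_energy_cong) (use assms continuous_version_eq in auto)

lemma form_domain_add:
  assumes "f \<in> form_domain" "g \<in> form_domain"
  shows "(\<lambda>x. f x + g x) \<in> form_domain"
proof -
  obtain h where h: "h \<in> finite_energy" "AE x in unit_lebesgue. f x = h x"
    using assms(1) by (rule form_domainE)
  obtain k where k: "k \<in> finite_energy" "AE x in unit_lebesgue. g x = k x"
    using assms(2) by (rule form_domainE)
  show ?thesis
  proof (rule form_domainI)
    show "(\<lambda>x. h x + k x) \<in> finite_energy" by (rule finite_energy_add_diff(1)[OF h(1) k(1)])
    show "AE x in unit_lebesgue. f x + g x = h x + k x" using h(2) k(2) by eventually_elim simp
    show "(\<lambda>x. f x + g x) \<in> borel_measurable unit_lebesgue"
      using assms form_domain_measurable by (intro borel_measurable_add) auto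
  qed
qed

lemma form_domain_scale:
  assumes "f \<in> form_domain"
  shows "(\<lambda>x. c * f x) \<in> form_domain"
proof -
  obtain h where h: "h \<in> finite_energy" "AE x in unit_lebesgue. f x = h x"
    using assms(1) by (rule form_domainE)
  show ?thesis
  proof (rule form_domainI)
    show "(\<lambda>x. c * h x) \<in> finite_energy" by (rule finite_energy_scale[OF h(1)])
    show "AE x in unit_lebesgue. c * f x = c * h x" using h(2) by eventually_elim simp
    show "(\<lambda>x. c * f x) \<in> borel_measurable unit_lebesgue"
      using assms form_domain_measurable by (intro borel_measurable_times) auto
  qed
qed

lemma form_inner_eq:
  assumes h: "h \<in> finite_energy" "AE x in unit_lebesgue. f x = h x"
    and m: "f \<in> borel_measurable unit_lebesgue"
  shows "form_inner unit_lebesgue form f f = energy_norm2 h"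
proof -
  have [measurable]: "f \<in> borel_measurable unit_lebesgue" "h \<in> borel_measurable unit_lebesgue"
    using m continuous_measurable_unit[OF finite_energy_continuous[OF h(1)]] by auto
  have "(\<integral>x. f x * f x \<partial>unit_lebesgue) = (\<integral>x. (h x)\<^sup>2 \<partial>unit_lebesgue)"
  proof (rule integral_cong_AE)
    show "AE x in unit_lebesgue. f x * f x = (h x)\<^sup>2" using h(2) by eventually_elim (simp add: power2_eq_square)
  qed measurable
  then show ?thesis using form_eq[OF h h] by (simp add: form_inner_def energy_norm2_def)
qed

text \<open>
  All axioms reduce to statements about continuous versions, where they have been shown for
  \<open>total_energy\<close>. For density, continuous functions are dense in the square-integrable ones and
  functions of finite energy are uniformly dense in the continuous ones.
\<close>

lemma dirichlet_form_grid: "dirichlet_form unit_lebesgue form form_domain"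
proof
  show "form_domain \<subseteq> L2 unit_lebesgue"
  proof
    fix f assume f: "f \<in> form_domain"
    then obtain h where h: "h \<in> finite_energy" "AE x in unit_lebesgue. f x = h x" by (rule form_domainE)
    have [measurable]: "f \<in> borel_measurable unit_lebesgue" by (rule form_domain_measurable[OF f])
    have hL: "h \<in> L2 unit_lebesgue" by (rule continuous_L2_unit[OF finite_energy_continuous[OF h(1)]])
    then have [measurable]: "h \<in> borel_measurable unit_lebesgue" by (simp add: L2_def)
    have "integrable unit_lebesgue (\<lambda>x. (f x)\<^sup>2) \<longleftrightarrow> integrable unit_lebesgue (\<lambda>x. (h x)\<^sup>2)"
    proof (rule integrable_cong_AE)
      show "AE x in unit_lebesgue. (f x)\<^sup>2 = (h x)\<^sup>2" using h(2) by eventually_elim simp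
    qed measurable
    then show "f \<in> L2 unit_lebesgue" using hL by (simp add: L2_def)
  qed
next
  fix f g :: "real \<Rightarrow> real"
  assume f: "f \<in> form_domain" and g: "g \<in> borel_measurable unit_lebesgue"
    and ae: "AE x in unit_lebesgue. f x = g x"
  obtain h where h: "h \<in> finite_energy" "AE x in unit_lebesgue. f x = h x" using f by (rule form_domainE)
  have "AE x in unit_lebesgue. g x = h x" using h(2) ae by eventually_elim simp
  then show "g \<in> form_domain" by (rule form_domainI[OF g h(1)])
next
  show "(\<lambda>x. 0) \<in> form_domain"
    by (intro finite_energy_in_domain finite_energyI[of _ 0]) (auto simp: energy_def incr_def)
next
  fix f g assume "f \<in> form_domain" "g \<in> form_domain"
  then show "(\<lambda>x. f x + g x) \<in> form_domain" by (rule form_domain_add)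
next
  fix c f assume "f \<in> form_domain"
  then show "(\<lambda>x. c * f x) \<in> form_domain" by (rule form_domain_scale)
next
  fix f :: "real \<Rightarrow> real" and e :: real
  assume f: "f \<in> L2 unit_lebesgue" and e: "e > 0"
  have e2: "e\<^sup>2 / 4 > 0" "e / 2 > 0" using e by simp_all
  obtain g where g: "continuous_on {0..1} g" "(\<integral>x. (f x - g x)\<^sup>2 \<partial>unit_lebesgue) < e\<^sup>2 / 4"
    using L2_approximable_L2[OF f] e2(1) unfolding L2_approximable_def by blast
  obtain h where h: "h \<in> finite_energy" "\<And>x. x \<in> {0..1} \<Longrightarrow> \<bar>g x - h x\<bar> < e / 2"
    using finite_energy_dense[OF g(1) e2(2)] by blast
  interpret finite_measure unit_lebesgue by (rule finite_measure_unit_lebesgue)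
  have m: "measure unit_lebesgue {0..1} = 1"
    using emeasure_unit_lebesgue_total by (simp add: emeasure_eq_measure)
  have L: "(\<lambda>x. f x - g x) \<in> L2 unit_lebesgue" "(\<lambda>x. g x - h x) \<in> L2 unit_lebesgue"
    by (intro L2_diff f continuous_L2_unit g finite_energy_continuous h)+
  have sq: "(g x - h x)\<^sup>2 \<le> (e / 2)\<^sup>2" if "x \<in> {0..1}" for x
    using h(2)[OF that] e by (simp only: abs_le_square_iff[symmetric])
  have "(\<integral>x. (g x - h x)\<^sup>2 \<partial>unit_lebesgue) \<le> (\<integral>x. (e / 2)\<^sup>2 \<partial>unit_lebesgue)"
    using L(2) sq by (intro integral_mono) (simp_all add: L2_def)
  then have "(\<integral>x. ((f x - g x) + (g x - h x))\<^sup>2 \<partial>unit_lebesgue) < e\<^sup>2"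
    using integral_square_add_le[OF L] g(2) m by (simp add: power_divide)
  then have h2: "(\<integral>x. (f x - h x)\<^sup>2 \<partial>unit_lebesgue) < e\<^sup>2" by simp
  have "L2_norm unit_lebesgue (\<lambda>x. f x - h x) < sqrt (e\<^sup>2)"
    unfolding L2_norm_def using h2 by (rule real_sqrt_less_mono)
  then show "\<exists>g\<in>form_domain. L2_norm unit_lebesgue (\<lambda>x. f x - g x) < e"
    using finite_energy_in_domain[OF h(1)] e by (intro bexI[of _ h]) simp_all
next
  fix f f' g assume f: "f \<in> form_domain" and g: "g \<in> form_domain"
    and ae: "AE x in unit_lebesgue. f x = f' x"
  obtain h where h: "h \<in> finite_energy" "AE x in unit_lebesgue. f x = h x" using f by (rule form_domainE)
  obtain k where k: "k \<in> finite_energy" "AE x in unit_lebesgue. g x = k x" using g by (rule form_domainE)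
  have "AE x in unit_lebesgue. f' x = h x" using h(2) ae by eventually_elim simp
  then show "form f g = form f' g" using form_eq[OF h k] form_eq[OF h(1) _ k] by simp
next
  fix f g show "form f g = form g f" by (simp add: form_def total_energy_sym)
next
  fix f g l assume f: "f \<in> form_domain" and g: "g \<in> form_domain" and l: "l \<in> form_domain"
  obtain h where h: "h \<in> finite_energy" "AE x in unit_lebesgue. f x = h x" using f by (rule form_domainE)
  obtain k where k: "k \<in> finite_energy" "AE x in unit_lebesgue. g x = k x" using g by (rule form_domainE)
  obtain m where m: "m \<in> finite_energy" "AE x in unit_lebesgue. l x = m x" using l by (rule form_domainE)
  have "AE x in unit_lebesgue. f x + g x = h x + k x" using h(2) k(2) by eventually_elim simp
  then have "form (\<lambda>x. f x + g x) l = total_energy (\<lambda>x. h x + k x) m"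
    by (intro form_eq finite_energy_add_diff h k m)
  then show "form (\<lambda>x. f x + g x) l = form f l + form g l"
    by (simp add: total_energy_add h k m form_eq[OF h m] form_eq[OF k m])
next
  fix c f g assume f: "f \<in> form_domain" and g: "g \<in> form_domain"
  obtain h where h: "h \<in> finite_energy" "AE x in unit_lebesgue. f x = h x" using f by (rule form_domainE)
  obtain k where k: "k \<in> finite_energy" "AE x in unit_lebesgue. g x = k x" using g by (rule form_domainE)
  have "AE x in unit_lebesgue. c * f x = c * h x" using h(2) by eventually_elim simp
  then have "form (\<lambda>x. c * f x) g = total_energy (\<lambda>x. c * h x) k"
    by (intro form_eq finite_energy_scale h k)
  then show "form (\<lambda>x. c * f x) g = c * form f g"
    by (simp add: total_energy_scale h k form_eq[OF h k])
next
  fix f assume f: "f \<in> form_domain"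
  obtain h where h: "h \<in> finite_energy" "AE x in unit_lebesgue. f x = h x" using f by (rule form_domainE)
  show "form f f \<ge> 0" using form_eq[OF h h] total_energy_nonneg[OF h(1)] by simp
next
  fix s :: "nat \<Rightarrow> real \<Rightarrow> real"
  assume s: "\<And>n. s n \<in> form_domain"
    and C: "\<And>\<epsilon>. \<epsilon> > 0 \<Longrightarrow> \<exists>N. \<forall>m\<ge>N. \<forall>n\<ge>N.
             sqrt (form_inner unit_lebesgue form (\<lambda>x. s m x - s n x) (\<lambda>x. s m x - s n x)) < \<epsilon>"
  have "\<forall>n. \<exists>h. h \<in> finite_energy \<and> (AE x in unit_lebesgue. s n x = h x)"
    using s by (blast elim: form_domainE)
  then obtain h where h: "\<And>n. h n \<in> finite_energy" "\<And>n. AE x in unit_lebesgue. s n x = h n x"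
    by metis
  have sm: "s n \<in> borel_measurable unit_lebesgue" for n by (rule form_domain_measurable[OF s])
  have inner: "form_inner unit_lebesgue form (\<lambda>x. s n x - g x) (\<lambda>x. s n x - g x)
      = energy_norm2 (\<lambda>x. h n x - k x)"
    if k: "k \<in> finite_energy" "AE x in unit_lebesgue. g x = k x" and g: "g \<in> borel_measurable unit_lebesgue"
    for n k g
  proof (rule form_inner_eq)
    show "(\<lambda>x. h n x - k x) \<in> finite_energy" by (rule finite_energy_add_diff(2)[OF h(1) k(1)])
    show "AE x in unit_lebesgue. s n x - g x = h n x - k x" using h(2)[of n] k(2) by eventually_elim simp
    show "(\<lambda>x. s n x - g x) \<in> borel_measurable unit_lebesgue" using sm g by (rule borel_measurable_diff)
  qed
  have "\<exists>K. \<forall>m\<ge>K. \<forall>n\<ge>K. energy_norm2 (\<lambda>x. h m x - h n x) < e" if e: "e > 0" for e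
  proof -
    have "sqrt e > 0" using e by simp
    from C[OF this] obtain K where "\<forall>m\<ge>K. \<forall>n\<ge>K. sqrt (energy_norm2 (\<lambda>x. h m x - h n x)) < sqrt e"
      using inner[OF h sm] by auto
    then show ?thesis by (intro exI[of _ K]) simp
  qed
  from finite_energy_complete[OF h(1) this]
  obtain g where g: "g \<in> finite_energy" "(\<lambda>n. energy_norm2 (\<lambda>x. h n x - g x)) \<longlonglongrightarrow> 0" by blast
  have "(\<lambda>n. sqrt (energy_norm2 (\<lambda>x. h n x - g x))) \<longlonglongrightarrow> sqrt 0"
    by (intro tendsto_real_sqrt g)
  then have "(\<lambda>n. sqrt (form_inner unit_lebesgue form (\<lambda>x. s n x - g x) (\<lambda>x. s n x - g x))) \<longlonglongrightarrow> 0"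
    using inner[OF g(1) _ continuous_measurable_unit[OF finite_energy_continuous[OF g(1)]]] by simp
  then show "\<exists>f\<in>form_domain. (\<lambda>n. sqrt (form_inner unit_lebesgue form
      (\<lambda>x. s n x - f x) (\<lambda>x. s n x - f x))) \<longlonglongrightarrow> 0"
    using finite_energy_in_domain[OF g(1)] by blast
next
  fix f assume f: "f \<in> form_domain"
  obtain h where h: "h \<in> finite_energy" "AE x in unit_lebesgue. f x = h x" using f by (rule form_domainE)
  have ae: "AE x in unit_lebesgue. min (max (f x) 0) 1 = min (max (h x) 0) 1"
    using h(2) by eventually_elim simp
  show "(\<lambda>x. min (max (f x) 0) 1) \<in> form_domain"
    using form_domain_measurable[OF f] ae
    by (intro form_domainI[OF _ unit_contraction_energy(1)[OF h(1)]]) (auto intro: borel_measurable_min borel_measurable_max)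
  show "form (\<lambda>x. min (max (f x) 0) 1) (\<lambda>x. min (max (f x) 0) 1) \<le> form f f"
    using form_eq[OF unit_contraction_energy(1)[OF h(1)] ae unit_contraction_energy(1)[OF h(1)] ae]
      form_eq[OF h h] unit_contraction_energy(2)[OF h(1)] by simp
qed

lemma regular_form_grid: "regular_form (top_of_set {0..1}) unit_lebesgue form form_domain"
  unfolding regular_form_def Cc_unit
proof (intro conjI ballI allI impI)
  fix f :: "real \<Rightarrow> real" and e :: real assume "f \<in> {f. continuous_on {0..1} f}" "e > 0"
  then obtain g where "g \<in> finite_energy" "\<forall>x\<in>{0..1}. \<bar>f x - g x\<bar> < e"
    using finite_energy_dense by blast
  then show "\<exists>g\<in>form_domain \<inter> {f. continuous_on {0..1} f}. \<forall>x\<in>topspace (top_of_set {0..1}). \<bar>f x - g x\<bar> < e"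
    using finite_energy_in_domain finite_energy_continuous by (intro bexI[of _ g]) auto
next
  fix f and e :: real assume f: "f \<in> form_domain" and e: "e > 0"
  obtain h where h: "h \<in> finite_energy" "AE x in unit_lebesgue. f x = h x" using f by (rule form_domainE)
  have ae: "AE x in unit_lebesgue. f x - h x = 0" using h(2) by eventually_elim simp
  have z: "(\<lambda>x. 0) \<in> finite_energy" by (intro finite_energyI[of _ 0]) (auto simp: energy_def incr_def)
  have [measurable]: "f \<in> borel_measurable unit_lebesgue" "h \<in> borel_measurable unit_lebesgue"
    using form_domain_measurable f finite_energy_in_domain h by auto
  have "(\<integral>x. (f x - h x)\<^sup>2 \<partial>unit_lebesgue) = (\<integral>x. 0 \<partial>unit_lebesgue)"
  proof (rule integral_cong_AE)
    show "AE x in unit_lebesgue. (f x - h x)\<^sup>2 = 0" using ae by eventually_elim simp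
  qed measurable
  moreover have "form (\<lambda>x. f x - h x) (\<lambda>x. f x - h x) = 0"
    using form_eq[OF z ae z ae] by (simp add: total_energy_def energy_def incr_def)
  ultimately have "form_norm unit_lebesgue form (\<lambda>x. f x - h x) < e"
    using e by (simp add: form_norm_def L2_norm_def)
  then show "\<exists>g\<in>form_domain \<inter> {f. continuous_on {0..1} f}. form_norm unit_lebesgue form (\<lambda>x. f x - g x) < e"
    using finite_energy_in_domain[OF h(1)] finite_energy_continuous[OF h(1)] by blast
qed

text \<open>
  A point outside the support lies off some closed \<open>C\<close> such that \<open>g\<close> vanishes almost everywhere on the
  relatively open complement of \<open>C\<close>; there the continuous version vanishes everywhere.
\<close>

lemma continuous_version_support:
  assumes k: "k \<in> finite_energy" "AE x in unit_lebesgue. g x = k x"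
    and g: "g \<in> borel_measurable unit_lebesgue"
    and x: "x \<in> {0..1}" "x \<notin> measure_support (top_of_set {0..1}) unit_lebesgue g"
  shows "k x = 0"
proof -
  obtain C where C: "closedin (top_of_set {0..1}) C"
    "(\<integral>\<^sup>+x \<in> topspace (top_of_set {0..1}) - C. ennreal \<bar>g x\<bar> \<partial>unit_lebesgue) = 0" "x \<notin> C"
    using x(2) by (auto simp: measure_support_def)
  have op: "openin (top_of_set {0..1}) ({0..1} - C)" using C(1) by (simp add: closedin_def)
  have [measurable]: "{0..1} - C \<in> sets unit_lebesgue" by (rule openin_unit_sets[OF op])
  note g[measurable]
  have "AE x in unit_lebesgue. ennreal \<bar>g x\<bar> * indicator ({0..1} - C) x = 0"
    using C(2) by (subst nn_integral_0_iff_AE[symmetric]) (simp_all add: mult.commute)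
  then have "AE x in unit_lebesgue. x \<in> {0..1} - C \<longrightarrow> k x = 0"
    using k(2) by eventually_elim (auto simp: indicator_def)
  then show ?thesis
    using C(3) x(1) by (intro continuous_AE_const_unit[OF finite_energy_continuous[OF k(1)] op]) auto
qed

lemma strongly_local_form_grid: "strongly_local_form (top_of_set {0..1}) unit_lebesgue form form_domain"
  unfolding strongly_local_form_def
proof (intro ballI impI)
  let ?supp = "measure_support (top_of_set {0..1}) unit_lebesgue"
  fix f g assume f: "f \<in> form_domain" and g: "g \<in> form_domain"
    and "compactin (top_of_set {0..1}) (?supp f) \<and> compactin (top_of_set {0..1}) (?supp g) \<and>
        (\<exists>U c. openin (top_of_set {0..1}) U \<and> ?supp g \<subseteq> U \<and> (AE x in unit_lebesgue. x \<in> U \<longrightarrow> f x = c))"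
  then obtain U c where S: "compact (?supp g)" and U: "openin (top_of_set {0..1}) U" "?supp g \<subseteq> U"
    and c: "AE x in unit_lebesgue. x \<in> U \<longrightarrow> f x = c"
    by (auto simp: compactin_subtopology)
  obtain h where h: "h \<in> finite_energy" "AE x in unit_lebesgue. f x = h x" using f by (rule form_domainE)
  obtain k where k: "k \<in> finite_energy" "AE x in unit_lebesgue. g x = k x" using g by (rule form_domainE)
  have "AE x in unit_lebesgue. x \<in> U \<longrightarrow> h x = c" using c h(2) by eventually_elim simp
  then have hc: "h x = c" if "x \<in> U" for x
    by (rule continuous_AE_const_unit[OF finite_energy_continuous[OF h(1)] U(1) _ that])
  have "total_energy h k = 0"
    by (rule total_energy_local[OF U(1) S U(2) hc])
      (use continuous_version_support[OF k form_domain_measurable[OF g]] in auto)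
  then show "form f g = 0" using form_eq[OF h k] by simp
qed

end

section \<open>Grids with two heavy children per cell\<close>

text \<open>
  The number of children of a cell of level \<open>n\<close>. It has to grow fast enough for \<open>2 / branch n\<close>, the
  fraction of heavy children, to be summable, but more slowly than every power of the
  number \<open>2 ^ n\<^sup>2\<close> of cells of level \<open>n\<close>.
\<close>

definition branch :: "nat \<Rightarrow> nat" where "branch n = 2 ^ (2 * n + 1)"

definition cells :: "nat \<Rightarrow> nat" where "cells n = 2 ^ n\<^sup>2"

lemma cells_Suc: "cells (Suc n) = cells n * branch n"
  by (simp add: cells_def branch_def power_add[symmetric] power2_eq_square)

lemma branch_ge: "2 \<le> branch n"
  by (simp add: branch_def)

lemma holder_continuous_imp_continuous_on:
  fixes f :: "real \<Rightarrow> real"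
  assumes H: "holder_continuous X dist \<alpha> f" and \<alpha>: "0 < \<alpha>"
  shows "continuous_on X f"
  unfolding continuous_on_def
proof
  fix x assume x: "x \<in> X"
  obtain K where K: "0 < K" "\<And>x y. x \<in> X \<Longrightarrow> y \<in> X \<Longrightarrow> \<bar>f x - f y\<bar> \<le> K * \<bar>x - y\<bar> powr \<alpha>"
    using H by (auto simp: holder_continuous_def dist_real_def)
  have "((\<lambda>y. \<bar>y - x\<bar> powr \<alpha>) \<longlongrightarrow> 0 powr \<alpha>) (at x within X)"
    using \<alpha> by (intro tendsto_powr2 tendsto_const tendsto_rabs_zero) (auto intro!: tendsto_eq_intros)
  then have "((\<lambda>y. \<bar>y - x\<bar> powr \<alpha>) \<longlongrightarrow> 0) (at x within X)" by simp
  then have "((\<lambda>y. K * \<bar>y - x\<bar> powr \<alpha>) \<longlongrightarrow> 0) (at x within X)"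
    by (rule tendsto_mult_right_zero)
  then have "((\<lambda>y. f y - f x) \<longlongrightarrow> 0) (at x within X)"
    by (rule Lim_null_comparison[rotated])
      (use K(2) x in \<open>auto simp: eventually_at_filter\<close>)
  then show "(f \<longlongrightarrow> f x) (at x within X)" by (simp add: LIM_zero_iff)
qed

text \<open>
  The length of a light child relative to its parent of level \<open>n\<close> is the power \<open>- p n\<close> of the number of
  children; \<open>p n = 1\<close> for all \<open>n\<close> would give equal cells.
\<close>

locale grid_weights =
  fixes p :: "nat \<Rightarrow> real"
  assumes p_ge: "1 \<le> p n"
begin

definition light :: "nat \<Rightarrow> real" where
  "light n = real (branch n) powr - p n"

text \<open>
  The length left over by the light children is divided between two heavy ones. A single heavy child
  could get a fraction that tends to \<open>1\<close> rapidly, and then the mesh would not tend to \<open>0\<close>; with two of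
  them the fraction is at most \<open>1/2\<close> (\<open>heavy_le\<close>).
\<close>

definition heavy :: "nat \<Rightarrow> real" where
  "heavy n = (1 - (real (branch n) - 2) * light n) / 2"

definition ratio :: "nat \<Rightarrow> nat \<Rightarrow> real" where
  "ratio n j = (if j < 2 then heavy n else light n)"

text \<open>
  The length of the \<open>i\<close>-th cell of level \<open>n\<close>; for \<open>n > 0\<close> its parent is the cell \<open>i div branch (n-1)\<close>, and
  \<open>i mod branch (n-1)\<close> is its position among the children.
\<close>

primrec weight :: "nat \<Rightarrow> nat \<Rightarrow> real" where
  "weight 0 i = 1"
| "weight (Suc n) i = weight n (i div branch n) * ratio n (i mod branch n)"

definition point :: "nat \<Rightarrow> nat \<Rightarrow> real" where
  "point n i = (\<Sum>k<i. weight n k)"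

lemma branch_real: "2 \<le> real (branch n)"
  using branch_ge[of n] by (metis of_nat_le_iff of_nat_numeral)

lemma light_pos: "0 < light n"
  using branch_real[of n] by (simp add: light_def)

lemma branch_light_le: "real (branch n) * light n \<le> 1"
proof -
  have "light n \<le> real (branch n) powr - 1"
    unfolding light_def using branch_real[of n] p_ge[of n] by (intro powr_mono) auto
  then show ?thesis
    using branch_real[of n] by (simp add: powr_minus field_simps)
qed

lemma light_le_heavy: "light n \<le> heavy n"
  using branch_light_le[of n] by (simp add: heavy_def algebra_simps)

lemma heavy_le: "heavy n \<le> 1 / 2"
  using mult_nonneg_nonneg[of "real (branch n) - 2" "light n"] branch_real[of n] light_pos[of n]
  by (simp add: heavy_def)

lemma ratio_bounds: "light n \<le> ratio n j" "ratio n j \<le> 1 / 2" "0 < ratio n j"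
  using light_le_heavy[of n] heavy_le[of n] light_pos[of n] by (auto simp: ratio_def)

lemma sum_ratio: "(\<Sum>j<branch n. ratio n j) = 1"
proof -
  have "(\<Sum>j<branch n. ratio n j) = (\<Sum>j=0..<2. ratio n j) + (\<Sum>j=2..<branch n. ratio n j)"
    using branch_ge[of n] by (simp add: sum.atLeastLessThan_concat lessThan_atLeast0)
  also have "(\<Sum>j=0..<2. ratio n j) = (\<Sum>j=0..<2::nat. heavy n)"
    by (intro sum.cong) (auto simp: ratio_def)
  also have "(\<Sum>j=2..<branch n. ratio n j) = (\<Sum>j=2..<branch n. light n)"
    by (intro sum.cong) (auto simp: ratio_def)
  finally show ?thesis using branch_ge[of n] by (simp add: heavy_def of_nat_diff diff_divide_distrib)
qed

lemma weight_pos: "0 < weight n i"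
  by (induction n arbitrary: i) (simp_all add: ratio_bounds)

lemma weight_le: "weight n i \<le> (1 / 2) ^ n"
proof (induction n arbitrary: i)
  case (Suc n)
  have "weight n (i div branch n) * ratio n (i mod branch n) \<le> (1 / 2) ^ n * (1 / 2)"
    using ratio_bounds less_imp_le[OF ratio_bounds(3)] by (intro mult_mono Suc) auto
  then show ?case by simp
qed simp

lemma weight_children: "(\<Sum>k=i * branch n..<i * branch n + branch n. weight (Suc n) k) = weight n i"
proof -
  have "(\<Sum>k=i * branch n..<i * branch n + branch n. weight (Suc n) k)
      = (\<Sum>j<branch n. weight (Suc n) (i * branch n + j))"
    by (simp add: sum.atLeastLessThan_shift_0[of _ "i * branch n"] lessThan_atLeast0)
  also have "\<dots> = (\<Sum>j<branch n. weight n i * ratio n j)"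
    by (intro sum.cong) auto
  also have "\<dots> = weight n i" by (simp add: sum_distrib_left[symmetric] sum_ratio)
  finally show ?thesis .
qed

lemma point_refine: "point (Suc n) (i * branch n) = point n i"
  unfolding point_def sum.nat_group[symmetric] weight_children ..

lemma point_Suc: "point n (Suc i) = point n i + weight n i"
  by (simp add: point_def)

lemma point_last: "point n (cells n) = 1"
  by (induction n) (simp_all add: cells_Suc point_refine, simp add: point_def cells_def)

sublocale refining_grid cells branch point
proof
  show "cells 0 = 1" by (simp add: cells_def)
  show "cells (Suc n) = cells n * branch n" for n by (rule cells_Suc)
  show "2 \<le> branch n" for n by (rule branch_ge)
  show "point n 0 = 0" for n by (simp add: point_def)
  show "point n (cells n) = 1" for n by (rule point_last)
  show "point n i < point n (Suc i)" for n i by (simp add: point_Suc weight_pos)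
  show "point (Suc n) (i * branch n) = point n i" for n i by (rule point_refine)
  fix e :: real assume "e > 0"
  then obtain n0 where n0: "(1/2) ^ n0 < e" using real_arch_pow_inv[of e "1/2"] by auto
  have "point n (Suc i) - point n i < e" if "n \<ge> n0" for n i
  proof -
    have "(1/2::real) ^ n \<le> (1/2) ^ n0" using that by (intro power_decreasing) auto
    then show ?thesis using weight_le[of n i] n0 unfolding point_Suc by linarith
  qed
  then show "\<exists>n0. \<forall>n\<ge>n0. \<forall>i<cells n. point n (Suc i) - point n i < e" by blast
qed

text \<open>
  Each step of the refinement multiplies by at least the light ratio, since heavy children are no
  shorter than light ones.
\<close>

lemma weight_ge:
  assumes "\<And>n. p n = P"
  shows "real (cells n) powr - P \<le> weight n i"
proof (induction n arbitrary: i)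
  case 0
  then show ?case by (simp add: cells_def)
next
  case (Suc n)
  have "real (cells (Suc n)) powr - P = real (cells n) powr - P * light n"
    by (simp add: cells_Suc powr_mult light_def assms)
  also have "\<dots> \<le> weight n (i div branch n) * ratio n (i mod branch n)"
    using Suc light_pos[of n] weight_pos[of n] ratio_bounds(1) by (intro mult_mono) (auto intro: less_imp_le)
  finally show ?case by simp
qed

text \<open>
  \<open>B\<close> consists of the cells with a heavy ancestor, or themselves heavy, after level \<open>k\<close>. Passing from
  level \<open>n\<close> to the next adds a fraction \<open>2 / branch n = 1 / 4 ^ n\<close> of all cells, and
  \<open>4/3 * (1 / 4 ^ k - 1 / 4 ^ n)\<close> is the value of the resulting geometric sum. The other cells
  have only light steps after level \<open>k\<close>, each with exponent \<open>p n \<ge> p k\<close>.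
\<close>

lemma few_heavy_cells:
  assumes mono: "incseq p" and kn: "k \<le> n"
  shows "\<exists>B. B \<subseteq> {..<cells n} \<and> real (card B) \<le> 4 / 3 * (1 / 4 ^ k - 1 / 4 ^ n) * real (cells n) \<and>
    (\<forall>i<cells n. i \<notin> B \<longrightarrow> weight n i \<le> (real (cells n) / real (cells k)) powr - p k)"
  using kn
proof (induction n rule: dec_induct)
  case base
  have "weight k i \<le> 1" for i
    using weight_le[of k i] power_le_one[of "1/2::real" k] by simp
  then show ?case using M_pos[of k] by (intro exI[of _ "{}"]) simp
next
  case (step n)
  then obtain B where B: "B \<subseteq> {..<cells n}"
    "real (card B) \<le> 4 / 3 * (1 / 4 ^ k - 1 / 4 ^ n) * real (cells n)"
    "\<And>i. i < cells n \<Longrightarrow> i \<notin> B \<Longrightarrow> weight n i \<le> (real (cells n) / real (cells k)) powr - p k"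
    by blast
  have fB: "finite B" using B(1) finite_subset by blast
  define b where "b = branch n"
  have b0: "b > 0" using branch_ge[of n] by (simp add: b_def)
  define B' where "B' = {i. i < cells (Suc n) \<and> (i div b \<in> B \<or> i mod b < 2)}"
  have "B' \<subseteq> (\<lambda>(q, r). q * b + r) ` (B \<times> {..<b} \<union> {..<cells n} \<times> {..<2})"
  proof
    fix i assume i: "i \<in> B'"
    then have "i div b < cells n"
      using b0 by (auto simp: B'_def cells_Suc b_def[symmetric] less_mult_imp_div_less)
    moreover have "i mod b < b" using b0 by simp
    ultimately have "(i div b, i mod b) \<in> B \<times> {..<b} \<union> {..<cells n} \<times> {..<2}"
      using i by (auto simp: B'_def)
    moreover have "i = (\<lambda>(q, r). q * b + r) (i div b, i mod b)" by simp
    ultimately show "i \<in> (\<lambda>(q, r). q * b + r) ` (B \<times> {..<b} \<union> {..<cells n} \<times> {..<2})" by blast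
  qed
  then have "card B' \<le> card ((\<lambda>(q, r). q * b + r) ` (B \<times> {..<b} \<union> {..<cells n} \<times> {..<2}))"
    using fB by (intro card_mono) auto
  also have "\<dots> \<le> card (B \<times> {..<b} \<union> {..<cells n} \<times> {..<2::nat})"
    using fB by (intro card_image_le) auto
  also have "\<dots> \<le> card B * b + cells n * 2"
    using card_Un_le[of "B \<times> {..<b}" "{..<cells n} \<times> {..<2::nat}"] by (simp add: card_cartesian_product)
  finally have "real (card B') \<le> real (card B) * real b + 2 * real (cells n)"
    by (metis (no_types, lifting) mult.commute of_nat_add of_nat_le_iff of_nat_mult of_nat_numeral)
  also have "\<dots> \<le> (4 / 3 * (1 / 4 ^ k - 1 / 4 ^ n) * real (cells n)) * real b + 2 * real (cells n)"
    using B(2) by (intro add_right_mono mult_right_mono) auto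
  also have "\<dots> = 4 / 3 * (1 / 4 ^ k - 1 / 4 ^ Suc n) * real (cells (Suc n))"
  proof -
    have "real b = 2 * 4 ^ n" by (simp add: b_def branch_def power_mult)
    then show ?thesis by (simp add: cells_Suc b_def[symmetric] field_simps)
  qed
  finally have card: "real (card B') \<le> 4 / 3 * (1 / 4 ^ k - 1 / 4 ^ Suc n) * real (cells (Suc n))" .
  have "weight (Suc n) i \<le> (real (cells (Suc n)) / real (cells k)) powr - p k"
    if i: "i < cells (Suc n)" "i \<notin> B'" for i
  proof -
    have q: "i div b < cells n" "i div b \<notin> B" "\<not> i mod b < 2"
      using i b0 by (auto simp: B'_def cells_Suc b_def[symmetric] less_mult_imp_div_less)
    have "weight (Suc n) i = weight n (i div b) * light n"
      using q(3) by (simp add: b_def ratio_def)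
    also have "\<dots> \<le> (real (cells n) / real (cells k)) powr - p k * real b powr - p k"
      unfolding light_def b_def[symmetric] using b0 incseqD[OF mono step(1)]
      by (intro mult_mono B(3) q powr_mono) auto
    also have "\<dots> = (real (cells (Suc n)) / real (cells k)) powr - p k"
      by (simp add: powr_mult[symmetric] cells_Suc b_def)
    finally show ?thesis .
  qed
  then show ?case using card by (intro exI[of _ B']) (auto simp: B'_def)
qed

section \<open>Hoelder functions of finite energy above the critical exponent are constant\<close>


text \<open>
  Split the cells into the set \<open>B\<close> of \<open>few_heavy_cells\<close> and the rest. On the rest the Hoelder bound
  gives a sum of order \<open>cells n powr (1 - \<alpha> * p k)\<close>, which tends to \<open>0\<close> for fixed \<open>k\<close>. On \<open>B\<close>,
  Cauchy-Schwarz bounds the sum by the square root of the energy times the fraction of cells in \<open>B\<close>, so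
  \<open>k\<close> is fixed first, according to the energy.
\<close>

lemma Holder_variation_vanishes:
  assumes mono: "incseq p" and f: "f \<in> finite_energy"
    and K: "0 < K" "\<And>x y. x \<in> {0..1} \<Longrightarrow> y \<in> {0..1} \<Longrightarrow> \<bar>f x - f y\<bar> \<le> K * \<bar>x - y\<bar> powr \<alpha>"
    and \<alpha>: "0 < \<alpha>" "\<And>k. k \<ge> k0 \<Longrightarrow> 1 < \<alpha> * p k" and e: "e > 0"
  shows "\<exists>n0. \<forall>n\<ge>n0. (\<Sum>i<cells n. \<bar>incr n f i\<bar>) < e"
proof -
  define C where "C = total_energy f f"
  have C0: "C \<ge> 0" using total_energy_nonneg[OF f] by (simp add: C_def)
  \<comment> \<open>\<open>k\<close> is chosen so that the part over \<open>B\<close> contributes less than \<open>e/2\<close>; the \<open>+ 1\<close> covers \<open>C = 0\<close>\<close>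
  define A where "A = 2 * (sqrt (4 / 3 * C) + 1)"
  have A0: "A > 0" using C0 by (simp add: A_def add_nonneg_pos)
  obtain k1 where k1: "(1/2::real) ^ k1 < e / A"
    using real_arch_pow_inv[of "e / A" "1/2"] e A0 by auto
  define k where "k = max k0 k1"
  have "(1/2::real) ^ k \<le> (1/2) ^ k1" by (intro power_decreasing) (auto simp: k_def)
  then have "(1/2::real) ^ k < e / A" using k1 by (rule le_less_trans)
  then have "(1/2::real) ^ k * (2 * (sqrt (4 / 3 * C) + 1)) < e"
    using A0 by (simp only: pos_less_divide_eq A_def)
  then have k: "sqrt (4 / 3 * C) * (1/2) ^ k < e / 2"
    using zero_less_power[of "1/2::real" k] by (simp only: distrib_left mult.commute) linarith
  have pk: "1 < \<alpha> * p k" using \<alpha>(2) by (simp add: k_def)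
  define c where "c = K * real (cells k) powr (\<alpha> * p k)"
  have "((\<lambda>x::real. c * x powr (1 - \<alpha> * p k)) \<longlongrightarrow> c * 0) at_top"
    using pk by (intro tendsto_intros tendsto_neg_powr filterlim_ident) auto
  moreover have "filterlim (\<lambda>n. real (cells n)) at_top sequentially"
  proof (rule filterlim_at_top_mono[OF filterlim_real_sequentially])
    have "n \<le> cells n" for n using M_ge[of n] less_exp[of n] by linarith
    then show "\<forall>\<^sub>F n in sequentially. real n \<le> real (cells n)" by simp
  qed
  ultimately have "((\<lambda>n. c * real (cells n) powr (1 - \<alpha> * p k)) \<longlongrightarrow> c * 0) sequentially"
    by (rule filterlim_compose)
  then have "\<forall>\<^sub>F n in sequentially. c * real (cells n) powr (1 - \<alpha> * p k) < e / 2"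
    using e by (intro order_tendstoD(2)) auto
  then obtain n1 where n1: "\<And>n. n \<ge> n1 \<Longrightarrow> c * real (cells n) powr (1 - \<alpha> * p k) < e / 2"
    by (auto simp: eventually_sequentially)
  have "(\<Sum>i<cells n. \<bar>incr n f i\<bar>) < e" if n: "n \<ge> max k n1" for n
  proof -
    obtain B where B: "B \<subseteq> {..<cells n}"
      "real (card B) \<le> 4 / 3 * (1 / 4 ^ k - 1 / 4 ^ n) * real (cells n)"
      "\<And>i. i < cells n \<Longrightarrow> i \<notin> B \<Longrightarrow> weight n i \<le> (real (cells n) / real (cells k)) powr - p k"
      using few_heavy_cells[OF mono, of k n] n by auto
    define m where "m = real (cells n)"
    have m0: "m > 0" using M_pos[of n] by (simp add: m_def)
    have light: "\<bar>incr n f i\<bar> \<le> K * ((m / real (cells k)) powr - p k) powr \<alpha>"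
      if i: "i \<in> {..<cells n} - B" for i
    proof -
      have "\<bar>incr n f i\<bar> \<le> K * \<bar>point n (Suc i) - point n i\<bar> powr \<alpha>"
        unfolding incr_def using i G_unit by (intro K) auto
      also have "\<dots> \<le> K * ((m / real (cells k)) powr - p k) powr \<alpha>"
        using B(3)[of i] i K(1) \<alpha>(1) weight_pos[of n i]
        by (intro mult_left_mono powr_mono2) (auto simp: point_Suc m_def)
      finally show ?thesis .
    qed
    have "(\<Sum>i\<in>{..<cells n} - B. \<bar>incr n f i\<bar>)
        \<le> (\<Sum>i\<in>{..<cells n} - B. K * ((m / real (cells k)) powr - p k) powr \<alpha>)"
      by (intro sum_mono light)
    also have "\<dots> \<le> (\<Sum>i\<in>{..<cells n}. K * ((m / real (cells k)) powr - p k) powr \<alpha>)"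
      using K(1) by (intro sum_mono2) auto
    also have "\<dots> = m * (K * ((m / real (cells k)) powr - p k) powr \<alpha>)"
      by (simp add: m_def)
    also have "\<dots> = c * m powr (1 - \<alpha> * p k)"
      using m0 M_pos[of k] unfolding c_def
      by (simp add: powr_powr powr_divide powr_diff powr_minus field_simps)
    also have "\<dots> < e / 2" using n1 n by (simp add: m_def)
    finally have l: "(\<Sum>i\<in>{..<cells n} - B. \<bar>incr n f i\<bar>) < e / 2" .
    have "(\<Sum>i\<in>B. \<bar>incr n f i\<bar>)\<^sup>2 \<le> (\<Sum>i\<in>B. \<bar>incr n f i\<bar>\<^sup>2) * real (card B)"
      by (rule sum_squared_le_sum_of_squares)
    also have "\<dots> \<le> (\<Sum>i<cells n. (incr n f i)\<^sup>2) * (4 / 3 * (1 / 4 ^ k) * m)"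
    proof (intro mult_mono sum_nonneg)
      show "(\<Sum>i\<in>B. \<bar>incr n f i\<bar>\<^sup>2) \<le> (\<Sum>i<cells n. (incr n f i)\<^sup>2)"
        using B(1) by (simp, intro sum_mono2) auto
      have "4 / 3 * (1 / 4 ^ k - 1 / 4 ^ n) * m \<le> 4 / 3 * (1 / 4 ^ k) * m"
        using m0 by (intro mult_right_mono mult_left_mono) auto
      then show "real (card B) \<le> 4 / 3 * (1 / 4 ^ k) * m" using B(2) by (simp add: m_def)
    qed auto
    also have "\<dots> = energy n f f * (4 / 3 * (1 / 4 ^ k))"
      by (simp add: energy_eq_squares m_def)
    also have "\<dots> \<le> C * (4 / 3 * (1 / 4 ^ k))"
      unfolding C_def using energy_le_total[OF f] by (intro mult_right_mono) auto
    also have "\<dots> = (sqrt (4 / 3 * C) * (1/2) ^ k)\<^sup>2"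
    proof -
      have "((1/2::real) ^ k)\<^sup>2 = ((1/2)\<^sup>2) ^ k" by (simp only: power_mult[symmetric] mult.commute[of k])
      also have "\<dots> = 1 / 4 ^ k" by (simp add: power_one_over power2_eq_square)
      finally have "((1/2::real) ^ k)\<^sup>2 = 1 / 4 ^ k" .
      moreover have "(sqrt (4 / 3 * C))\<^sup>2 = 4 / 3 * C" using C0 by simp
      ultimately show ?thesis by (simp only: power_mult_distrib)
    qed
    finally have "(\<Sum>i\<in>B. \<bar>incr n f i\<bar>) \<le> sqrt (4 / 3 * C) * (1/2) ^ k"
      by (rule power2_le_imp_le) (simp add: C0)
    then have h: "(\<Sum>i\<in>B. \<bar>incr n f i\<bar>) < e / 2" using k by linarith
    have "(\<Sum>i<cells n. \<bar>incr n f i\<bar>) = (\<Sum>i\<in>{..<cells n} - B. \<bar>incr n f i\<bar>) + (\<Sum>i\<in>B. \<bar>incr n f i\<bar>)"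
      using B(1) by (intro sum.subset_diff) auto
    then show ?thesis using l h by linarith
  qed
  then show ?thesis by blast
qed

lemma Holder_finite_energy_constant:
  assumes mono: "incseq p" and f: "f \<in> finite_energy"
    and K: "0 < K" "\<And>x y. x \<in> {0..1} \<Longrightarrow> y \<in> {0..1} \<Longrightarrow> \<bar>f x - f y\<bar> \<le> K * \<bar>x - y\<bar> powr \<alpha>"
    and \<alpha>: "0 < \<alpha>" "\<And>k. k \<ge> k0 \<Longrightarrow> 1 < \<alpha> * p k" and x: "x \<in> {0..1}"
  shows "f x = f 0"
proof -
  have "\<bar>f x - f 0\<bar> \<le> 0"
  proof (rule field_le_epsilon)
    fix e :: real assume e: "e > 0"
    obtain d where d: "d > 0" "\<And>z. z \<in> {0..1} \<Longrightarrow> \<bar>z - x\<bar> < d \<Longrightarrow> \<bar>f z - f x\<bar> < e/2"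
      using finite_energy_continuous[OF f] x e unfolding continuous_on_iff dist_real_def
      by (meson half_gt_zero)
    obtain n0 where n0: "\<And>n. n \<ge> n0 \<Longrightarrow> (\<Sum>i<cells n. \<bar>incr n f i\<bar>) < e / 2"
      using Holder_variation_vanishes[OF mono f K \<alpha>, where e = "e / 2"] e by auto
    obtain n1 where n1: "\<And>n. n \<ge> n1 \<Longrightarrow> \<exists>i\<le>cells n. \<bar>point n i - x\<bar> < d"
      using grid_near[OF x d(1)] by auto
    define n where "n = max n0 n1"
    obtain j where j: "j \<le> cells n" "\<bar>point n j - x\<bar> < d" using n1[of n] by (auto simp: n_def)
    have "\<bar>f (point n j) - f 0\<bar> = \<bar>\<Sum>i=0..<j. incr n f i\<bar>"
      using sum_incr[of 0 j n f] by (simp add: G_first)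
    also have "\<dots> \<le> (\<Sum>i=0..<j. \<bar>incr n f i\<bar>)" by (rule sum_abs)
    also have "\<dots> \<le> (\<Sum>i<cells n. \<bar>incr n f i\<bar>)" using j by (intro sum_mono2) auto
    also have "\<dots> < e / 2" by (rule n0) (simp add: n_def)
    finally have "\<bar>f (point n j) - f 0\<bar> < e / 2" .
    moreover have "\<bar>f (point n j) - f x\<bar> < e / 2" using d(2) j G_unit by auto
    ultimately show "\<bar>f x - f 0\<bar> \<le> 0 + e" by linarith
  qed
  then show ?thesis by simp
qed

lemma Holder_domain_constant:
  assumes mono: "incseq p" and f: "f \<in> form_domain" and H: "holder_continuous {0..1} dist \<alpha> f"
    and \<alpha>: "0 < \<alpha>" "\<And>k. k \<ge> k0 \<Longrightarrow> 1 < \<alpha> * p k"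
  shows "f constant_on {0..1}"
proof -
  obtain K where K: "0 < K" "\<And>x y. x \<in> {0..1} \<Longrightarrow> y \<in> {0..1} \<Longrightarrow> \<bar>f x - f y\<bar> \<le> K * \<bar>x - y\<bar> powr \<alpha>"
    using H by (auto simp: holder_continuous_def dist_real_def)
  have c: "continuous_on {0..1} f" by (rule holder_continuous_imp_continuous_on[OF H \<alpha>(1)])
  obtain h where h: "h \<in> finite_energy" "AE x in unit_lebesgue. f x = h x" using f by (rule form_domainE)
  have "f x = h x" if "x \<in> {0..1}" for x
    by (rule continuous_AE_eq_unit[OF c finite_energy_continuous[OF h(1)] h(2) that])
  then have fe: "f \<in> finite_energy" using finite_energy_cong[of f h] h(1) by simp
  have "f x = f 0" if "x \<in> {0..1}" for x
    by (rule Holder_finite_energy_constant[OF mono fe K \<alpha> that])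
  then show ?thesis unfolding constant_on_def by blast
qed

section \<open>The coordinate is Hoelder below the critical exponent\<close>

text \<open>
  For \<open>x < y\<close> take the first level \<open>n\<close> with \<open>2 / cells n\<close> below the gap of the coordinate. Then a complete
  cell of level \<open>n\<close> lies between \<open>x\<close> and \<open>y\<close>, so \<open>y - x\<close> is at least \<open>cells n powr - P\<close>, while the gap is at
  most \<open>2 / cells (n-1)\<close> by minimality. As \<open>\<alpha> * P < 1\<close>, the two numbers of cells are close enough for
  the Hoelder bound.
\<close>

lemma coordinate_Holder:
  assumes P: "\<And>n. p n = P" and \<alpha>: "0 < \<alpha>" "\<alpha> * P < 1"
  shows "\<exists>K>0. \<forall>x\<in>{0..1}. \<forall>y\<in>{0..1}. \<bar>coordinate x - coordinate y\<bar> \<le> K * \<bar>x - y\<bar> powr \<alpha>"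
proof -
  define q where "q = \<alpha> * P"
  have q: "q < 1" by (simp add: q_def \<alpha>)
  define K where "K = 2 * 2 powr (q / (1 - q))"
  have "K > 0" by (simp add: K_def)
  \<comment> \<open>the maximum over real \<open>n\<close>, found by completing the square\<close>
  have exponent: "q * (real n + 1)\<^sup>2 - (real n)\<^sup>2 \<le> q / (1 - q)" for n
  proof -
    have "(1 - q) * (q * (real n + 1)\<^sup>2 - (real n)\<^sup>2) = q - (q - (1 - q) * real n)\<^sup>2"
      by (simp add: power2_eq_square algebra_simps)
    also have "\<dots> \<le> q" by simp
    finally show ?thesis using q by (simp add: field_simps)
  qed
  have step: "2 / real (cells m) \<le> K * (real (cells (Suc m)) powr - P) powr \<alpha>" for m
  proof -
    have c: "real (cells n) = 2 powr ((real n)\<^sup>2)" for n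
      by (simp add: cells_def powr_realpow[symmetric])
    have "2 / real (cells m) = 2 * 2 powr (- (real m)\<^sup>2)" by (simp add: c powr_minus divide_inverse)
    also have "\<dots> \<le> 2 * 2 powr (q / (1 - q) - q * (real m + 1)\<^sup>2)"
      using exponent[of m] by simp
    also have "\<dots> = K * 2 powr (- q * (real m + 1)\<^sup>2)"
      by (simp add: K_def powr_diff powr_minus divide_inverse)
    also have "2 powr (- q * (real m + 1)\<^sup>2) = (real (cells (Suc m)) powr - P) powr \<alpha>"
      by (simp add: c powr_powr q_def algebra_simps)
    finally show ?thesis .
  qed
  have main: "coordinate y - coordinate x \<le> K * \<bar>x - y\<bar> powr \<alpha>"
    if xy: "0 \<le> x" "x < y" "y \<le> 1" for x y
  proof -
    define D where "D = coordinate y - coordinate x"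
    have D0: "D > 0" using coordinate_strict[OF xy] by (simp add: D_def)
    have D1: "D \<le> 1"
      using coordinate_mono[of 0 x] coordinate_mono[of y 1] xy coordinate_grid[of 0 0] coordinate_grid[of "cells 0" 0]
        G_first[of 0] G_last[of 0] M_pos[of 0] by (simp add: D_def)
    have ex: "\<exists>n. 2 / real (cells n) < D" by (rule M_eventually_large[OF D0])
    define n where "n = (LEAST n. 2 / real (cells n) < D)"
    have n: "2 / real (cells n) < D" unfolding n_def by (rule LeastI_ex[OF ex])
    have "n \<noteq> 0"
    proof
      assume "n = 0"
      then have "2 / real (cells 0) < D" using n by (simp only:)
      then show False using D1 by (simp add: M_0)
    qed
    then obtain m where m: "n = Suc m" by (cases n) auto
    have Dm: "D \<le> 2 / real (cells m)"
      using not_less_Least[of m "\<lambda>n. 2 / real (cells n) < D"] m unfolding n_def by simp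
    obtain i where i: "i < cells n" "x \<le> point n i" "point n (Suc i) \<le> y"
      using full_cell_between[of x y n] xy n by (auto simp: D_def)
    have "real (cells n) powr - P \<le> weight n i" by (rule weight_ge[OF P])
    also have "\<dots> \<le> \<bar>x - y\<bar>" using i xy by (simp add: point_Suc)
    finally have w: "real (cells n) powr - P \<le> \<bar>x - y\<bar>" .
    have "D \<le> K * (real (cells n) powr - P) powr \<alpha>" using Dm step[of m] by (simp add: m)
    also have "\<dots> \<le> K * \<bar>x - y\<bar> powr \<alpha>"
      using w \<alpha>(1) \<open>K > 0\<close> by (intro mult_left_mono powr_mono2) auto
    finally show ?thesis by (simp add: D_def)
  qed
  have "\<bar>coordinate x - coordinate y\<bar> \<le> K * \<bar>x - y\<bar> powr \<alpha>" if "x \<in> {0..1}" "y \<in> {0..1}" for x y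
  proof (cases x y rule: linorder_cases)
    case less
    then show ?thesis using main[of x y] coordinate_mono[of x y] that by simp
  next
    case equal
    then show ?thesis using \<open>K > 0\<close> by simp
  next
    case greater
    then show ?thesis using main[of y x] coordinate_mono[of y x] that by (simp add: abs_minus_commute)
  qed
  then show ?thesis using \<open>K > 0\<close> by blast
qed

end

section \<open>Every critical exponent is attained\<close>

theorem theorem1p1:
  fixes \<delta> :: real
  assumes "0 \<le> \<delta>" and "\<delta> \<le> 1"
  shows "\<exists>(X :: real set) d \<mu> E F.
           metric_measure_space X d \<mu> \<and>
           dirichlet_form \<mu> E F \<and>
           regular_form (Metric_space.mtopology X d) \<mu> E F \<and>
           strongly_local_form (Metric_space.mtopology X d) \<mu> E F \<and>
           critical_holder_exponent X d F = \<delta>"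
proof -
  \<comment> \<open>for \<open>\<delta> = 0\<close> the exponents must eventually exceed \<open>1 / \<alpha>\<close> for every \<open>\<alpha> > 0\<close>\<close>
  define p :: "nat \<Rightarrow> real" where "p n = (if \<delta> = 0 then real n + 1 else 1 / \<delta>)" for n
  have p1: "1 \<le> p n" for n using assms by (auto simp: p_def)
  interpret grid_weights p by unfold_locales (rule p1)
  have mono: "incseq p" by (auto simp: incseq_def p_def)
  have above: "f constant_on {0..1}"
    if "f \<in> form_domain" "holder_continuous {0..1} dist \<alpha> f" "\<delta> < \<alpha>" for f \<alpha>
  proof -
    have \<alpha>0: "0 < \<alpha>" using that assms by simp
    obtain k0 where k0: "1 / \<alpha> < real k0" using reals_Archimedean2 by blast
    have "1 < \<alpha> * p k" if "k \<ge> k0" for k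
    proof (cases "\<delta> = 0")
      case True
      have "1 / \<alpha> < p k" using k0 that True by (simp add: p_def)
      then show ?thesis using \<alpha>0 by (simp add: field_simps)
    next
      case False
      then show ?thesis using \<open>\<delta> < \<alpha>\<close> assms by (simp add: p_def field_simps)
    qed
    then show ?thesis using Holder_domain_constant[OF mono that(1,2) \<alpha>0] by blast
  qed
  have below: "\<alpha> \<in> holder_exponents {0..1} dist form_domain" if "0 < \<alpha>" "\<alpha> < \<delta>" for \<alpha>
  proof -
    have "\<exists>K>0. \<forall>x\<in>{0..1}. \<forall>y\<in>{0..1}. \<bar>coordinate x - coordinate y\<bar> \<le> K * \<bar>x - y\<bar> powr \<alpha>"
      by (rule coordinate_Holder[of "1 / \<delta>"]) (use that assms in \<open>auto simp: p_def\<close>)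
    then have "holder_continuous {0..1} dist \<alpha> coordinate"
      by (simp add: holder_continuous_def dist_real_def)
    moreover have "\<not> coordinate constant_on {0..1}"
      using coordinate_strict[of 0 1] unfolding constant_on_def
      by (metis atLeastAtMost_iff less_irrefl order_refl zero_le_one zero_less_one)
    moreover have "coordinate \<in> form_domain"
      by (intro finite_energy_in_domain coordinate_Lipschitz_finite_energy[of _ 1] coordinate_continuous) auto
    ultimately show ?thesis using that assms unfolding holder_exponents_def by auto
  qed
  have le: "\<alpha> \<le> \<delta>" "0 < \<alpha>" if "\<alpha> \<in> holder_exponents {0..1} dist form_domain" for \<alpha>
    using that above by (force simp: holder_exponents_def)+
  have "critical_holder_exponent {0..1} dist form_domain = \<delta>"
  proof (cases "\<delta> = 0")
    case True
    then have "holder_exponents {0..1} dist form_domain = {}" using le by force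
    then show ?thesis using True by (simp add: critical_holder_exponent_def)
  next
    case False
    then have d0: "0 < \<delta>" using assms by simp
    then have "\<delta> / 2 \<in> holder_exponents {0..1} dist form_domain" by (intro below) auto
    moreover from this have "Sup (holder_exponents {0..1} dist form_domain) = \<delta>"
    proof (intro cSup_eq_non_empty)
      fix y assume y: "\<And>x. x \<in> holder_exponents {0..1} dist form_domain \<Longrightarrow> x \<le> y"
      show "\<delta> \<le> y"
      proof (rule dense_le_bounded[OF d0])
        fix w assume "0 < w" "w < \<delta>"
        then show "w \<le> y" by (intro y below)
      qed
    qed (use le in auto)
    ultimately show ?thesis by (auto simp: critical_holder_exponent_def)
  qed
  then show ?thesis
    using metric_measure_space_unit dirichlet_form_grid regular_form_grid strongly_local_form_grid
    by (intro exI[of _ "{0..1}"] exI[of _ dist] exI[of _ unit_lebesgue] exI[of _ form] exI[of _ form_domain])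
      (simp add: mtopology_unit)
qed

end
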